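(* Let $m,n\ge 3$ be integers. The combinatorial symmetry group of $E_{mn}$ contains a subgroup $G$ isomorphic to $\mathbb{Z}_m\times\mathbb{Z}_n$ induced by rotation in the two polygon factors. The geometric symmetry group of a polytope $P_{mn}$ combinatorially equivalent to $E_{mn}$ can contain a subgroup inducing $G$ on the face lattice only for $$(m,n)\in\{(3,3),(3,4),(3,5),(3,6),(4,4)\}$$ (up to interchanging $m$ and $n$).
   Context: $C_k$ denotes a convex polygon with $k$ vertices, numbered cyclically with indices modulo $k$. For a $d$-polytope $P$, $E(P)$ is the regular CW $(d-1)$-sphere obtained from the boundary of $P$ by stellarly subdividing every facet $F$ of $P$ (adding a new vertex $v_F$) and then merging the two facets of the subdivision that share a ridge (face of dimension $d-2$) of $P$; so the facets of $E(P)$ are combinatorially bipyramids over the ridges $R=F\cap F'$ of $P$ with apices $v_F$ and $v_{F'}$. $E_{mn}$ is (the combinatorial type of) $E(C_m\times C_n)$. Explicitly, with $i\in\mathbb{Z}/m$ and $j\in\mathbb{Z}/n$, its vertices are $v_{ij}$ (the vertices of $C_m\times C_n$), $v'_i$ (the new vertex of the facet $e_i\times C_n$, where $e_i$ is the edge of $C_m$ joining vertices $i$ and $i+1$) and $v''_j$ (the new vertex of the facet $C_m\times e_j$, where $e_j$ is the edge of $C_n$ joining vertices $j$ and $j+1$). Its facets have vertex sets $\{v_{ij},v_{i+1,j},v_{i,j+1},v_{i+1,j+1},v'_i,v''_j\}$, $\{v_{ij}: j\in\mathbb{Z}/n\}\cup\{v'_{i-1},v'_i\}$ and $\{v_{ij}: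 i\in\mathbb{Z}/m\}\cup\{v''_{j-1},v''_j\}$. It is the face lattice of a $4$-polytope. The combinatorial symmetry group of a polytope is the automorphism group of its face lattice (the poset of its faces ordered by inclusion). The geometric symmetry group of a geometrically realised polytope is the group of affine transformations of the ambient space preserving it set-wise; each such transformation induces a combinatorial symmetry. Rotation in the two polygon factors: $G$ is generated by the two combinatorial symmetries $\tilde S_m: v_{ij}\mapsto v_{i+1,j},\ v'_i\mapsto v'_{i+1},\ v''_j\mapsto v''_j$ and $\tilde S_n: v_{ij}\mapsto v_{i,j+1},\ v'_i\mapsto v'_i,\ v''_j\mapsto v''_{j+1}$. *)

theory Defs
  imports "HOL-Analysis.Analysis" "HOL-Algebra.Bij" "HOL-Algebra.Elementary_Groups"
begin

section \<open>Posets of sets and their automorphism groups\<close>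

definition inclusion_iso :: "('a set \<Rightarrow> 'b set) \<Rightarrow> 'a set set \<Rightarrow> 'b set set \<Rightarrow> bool" where
  "inclusion_iso \<psi> A B \<longleftrightarrow>
     bij_betw \<psi> A B \<and> (\<forall>X\<in>A. \<forall>Y\<in>A. X \<subseteq> Y \<longleftrightarrow> \<psi> X \<subseteq> \<psi> Y)"

definition comb_symmetry_group :: "'a set set \<Rightarrow> ('a set \<Rightarrow> 'a set) monoid" where
  "comb_symmetry_group L =
     (BijGroup L)\<lparr>carrier := {\<phi> \<in> Bij L. inclusion_iso \<phi> L L}\<rparr>"

section \<open>The combinatorial type \<open>E\<^sub>m\<^sub>n\<close>\<close>

text \<open>
  \<open>Vtx i j\<close> is \<open>v\<^sub>i\<^sub>j\<close>, \<open>Prime i\<close> is \<open>v'\<^sub>i\<close> and \<open>DPrime j\<close> is \<open>v''\<^sub>j\<close>. The residues modulo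
  \<open>m\<close> and \<open>n\<close> are represented by the naturals below \<open>m\<close> and \<open>n\<close>; predecessors are
  written with \<open>+ (m - 1)\<close> because subtraction on naturals truncates.
\<close>

datatype emn_vertex = Vtx nat nat | Prime nat | DPrime nat

definition emn_vertices :: "nat \<Rightarrow> nat \<Rightarrow> emn_vertex set" where
  "emn_vertices m n =
     {Vtx i j |i j. i < m \<and> j < n} \<union> {Prime i |i. i < m} \<union> {DPrime j |j. j < n}"

definition emn_facets :: "nat \<Rightarrow> nat \<Rightarrow> emn_vertex set set" where
  "emn_facets m n =
     {{Vtx i j, Vtx ((i + 1) mod m) j, Vtx i ((j + 1) mod n),
       Vtx ((i + 1) mod m) ((j + 1) mod n), Prime i, DPrime j} |i j. i < m \<and> j < n}
   \<union> {{Vtx i j |j. j < n} \<union> {Prime ((i + (m - 1)) mod m), Prime i} |i. i < m}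
   \<union> {{Vtx i j |i. i < m} \<union> {DPrime ((j + (n - 1)) mod n), DPrime j} |j. j < n}"

text \<open>
  Faces are identified with their vertex sets. In the face lattice of a polytope every
  face is the meet of the facets containing it, so the vertex sets of the faces are
  exactly the intersections of vertex sets of facets; the empty family of facets gives
  the improper face consisting of all vertices.
\<close>

definition emn_face_lattice :: "nat \<Rightarrow> nat \<Rightarrow> emn_vertex set set" where
  "emn_face_lattice m n = {emn_vertices m n \<inter> \<Inter>\<F> |\<F>. \<F> \<subseteq> emn_facets m n}"

fun rot_fst :: "nat \<Rightarrow> emn_vertex \<Rightarrow> emn_vertex" where
  "rot_fst m (Vtx i j) = Vtx ((i + 1) mod m) j"
| "rot_fst m (Prime i) = Prime ((i + 1) mod m)"
| "rot_fst m (DPrime j) = DPrime j"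

fun rot_snd :: "nat \<Rightarrow> emn_vertex \<Rightarrow> emn_vertex" where
  "rot_snd n (Vtx i j) = Vtx i ((j + 1) mod n)"
| "rot_snd n (Prime i) = Prime i"
| "rot_snd n (DPrime j) = DPrime ((j + 1) mod n)"

definition S_fst :: "nat \<Rightarrow> nat \<Rightarrow> emn_vertex set \<Rightarrow> emn_vertex set" where
  "S_fst m n = (\<lambda>F\<in>emn_face_lattice m n. rot_fst m ` F)"

definition S_snd :: "nat \<Rightarrow> nat \<Rightarrow> emn_vertex set \<Rightarrow> emn_vertex set" where
  "S_snd m n = (\<lambda>F\<in>emn_face_lattice m n. rot_snd n ` F)"

definition rotation_subgroup :: "nat \<Rightarrow> nat \<Rightarrow> (emn_vertex set \<Rightarrow> emn_vertex set) set" where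
  "rotation_subgroup m n =
     generate (comb_symmetry_group (emn_face_lattice m n)) {S_fst m n, S_snd m n}"

section \<open>Geometric realisations\<close>

definition face_lattice :: "'a::euclidean_space set \<Rightarrow> 'a set set" where
  "face_lattice P = {F. F face_of P}"

definition affine_transformation :: "('a::euclidean_space \<Rightarrow> 'a) \<Rightarrow> bool" where
  "affine_transformation f \<longleftrightarrow> (\<exists>c g. linear g \<and> bij g \<and> f = (\<lambda>x. c + g x))"

definition geom_symmetry_group :: "'a::euclidean_space set \<Rightarrow> ('a \<Rightarrow> 'a) monoid" where
  "geom_symmetry_group P =
     (BijGroup UNIV)\<lparr>carrier := {f. affine_transformation f \<and> f ` P = P}\<rparr>"

definition induced_symmetry :: "'a::euclidean_space set \<Rightarrow> ('a \<Rightarrow> 'a) \<Rightarrow> 'a set \<Rightarrow> 'a set" where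
  "induced_symmetry P f = (\<lambda>F\<in>face_lattice P. f ` F)"

text \<open>
  A combinatorial equivalence \<open>\<psi>\<close> from a lattice \<open>L\<close> to the face lattice of \<open>P\<close> carries a
  symmetry of \<open>L\<close> to one of \<open>P\<close> by conjugation.
\<close>

definition transport ::
  "('b set \<Rightarrow> 'a::euclidean_space set) \<Rightarrow> 'b set set \<Rightarrow> 'a set \<Rightarrow> ('b set \<Rightarrow> 'b set) \<Rightarrow> 'a set \<Rightarrow> 'a set"
  where "transport \<psi> L P \<phi> = (\<lambda>F\<in>face_lattice P. \<psi> (\<phi> (inv_into L \<psi> F)))"

definition induces_via ::
  "('b set \<Rightarrow> 'a::euclidean_space set) \<Rightarrow> 'b set set \<Rightarrow> 'a set
     \<Rightarrow> ('a \<Rightarrow> 'a) set \<Rightarrow> ('b set \<Rightarrow> 'b set) set \<Rightarrow> bool"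
  where "induces_via \<psi> L P H G \<longleftrightarrow> induced_symmetry P ` H = transport \<psi> L P ` G"

section \<open>Well-definedness\<close>

lemma group_comb_symmetry_group: "group (comb_symmetry_group L)"
proof -
  interpret B: group "BijGroup L" by (rule group_BijGroup)
  have "subgroup {\<phi> \<in> Bij L. inclusion_iso \<phi> L L} (BijGroup L)"
  proof (rule B.subgroupI)
    show "{\<phi> \<in> Bij L. inclusion_iso \<phi> L L} \<noteq> {}"
    proof -
      have "(\<lambda>x\<in>L. x) \<in> {\<phi> \<in> Bij L. inclusion_iso \<phi> L L}"
        using id_Bij[of L] by (simp add: inclusion_iso_def Bij_def)
      then show ?thesis by blast
    qed
  next
    fix a assume a: "a \<in> {\<phi> \<in> Bij L. inclusion_iso \<phi> L L}"
    then have bij: "a \<in> Bij L" "bij_betw a L L" by (auto simp: inclusion_iso_def)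
    have inv: "inv_into L a X \<in> L" "a (inv_into L a X) = X" if "X \<in> L" for X
      using that bij(2) by (auto simp: bij_betw_def inv_into_into f_inv_into_f)
    have "inclusion_iso (\<lambda>x\<in>L. inv_into L a x) L L"
      using a inv bij_betw_inv_into[OF bij(2)]
      by (auto simp: inclusion_iso_def cong: bij_betw_cong)
    then show "inv\<^bsub>BijGroup L\<^esub> a \<in> {\<phi> \<in> Bij L. inclusion_iso \<phi> L L}"
      using bij by (simp add: inv_BijGroup restrict_inv_into_Bij)
  next
    fix a b assume ab: "a \<in> {\<phi> \<in> Bij L. inclusion_iso \<phi> L L}"
      "b \<in> {\<phi> \<in> Bij L. inclusion_iso \<phi> L L}"
    then have "b X \<in> L" if "X \<in> L" for X
      using that by (auto simp: inclusion_iso_def bij_betw_def)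
    moreover from ab have c: "compose L a b \<in> Bij L" by (auto intro: compose_Bij)
    moreover from c have "bij_betw (compose L a b) L L" by (simp add: Bij_def)
    ultimately show "a \<otimes>\<^bsub>BijGroup L\<^esub> b \<in> {\<phi> \<in> Bij L. inclusion_iso \<phi> L L}"
      using ab by (auto simp: BijGroup_def inclusion_iso_def compose_eq)
  qed (auto simp: BijGroup_def)
  then show ?thesis
    unfolding comb_symmetry_group_def by (rule B.subgroup_imp_group)
qed

lemma group_geom_symmetry_group: "group (geom_symmetry_group P)"
proof -
  interpret B: group "BijGroup (UNIV :: 'a set)" by (rule group_BijGroup)
  have bij: "bij f" if aff: "affine_transformation f" for f :: "'a \<Rightarrow> 'a"
  proof -
    obtain c g where "linear g" "bij g" and f: "f = (\<lambda>x. c + g x)"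
      using aff unfolding affine_transformation_def by blast
    then have "bij ((+) c \<circ> g)" by (intro bij_comp) (auto simp: bij_def)
    then show ?thesis by (simp add: f o_def)
  qed
  have Bij_UNIV: "f \<in> Bij UNIV \<longleftrightarrow> bij f" for f :: "'a \<Rightarrow> 'a"
    by (auto simp: Bij_def)
  have "subgroup {f. affine_transformation f \<and> f ` P = P} (BijGroup UNIV)"
  proof (rule B.subgroupI)
    show "{f. affine_transformation f \<and> f ` P = P} \<subseteq> carrier (BijGroup UNIV)"
      by (auto simp: BijGroup_def Bij_UNIV bij)
    have "affine_transformation (\<lambda>x::'a. x)"
      unfolding affine_transformation_def
      by (intro exI[of _ 0] exI[of _ "\<lambda>x. x"]) (auto simp: linear_iff bij_def inj_on_def)
    then show "{f. affine_transformation f \<and> f ` P = P} \<noteq> {}" by force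
  next
    fix f :: "'a \<Rightarrow> 'a" assume f: "f \<in> {f. affine_transformation f \<and> f ` P = P}"
    then obtain c g where g: "linear g" "bij g" and feq: "f = (\<lambda>x. c + g x)"
      unfolding affine_transformation_def by blast
    have bf: "bij f" using f bij by auto
    define f' g' where "f' = inv_into UNIV f" and "g' = inv_into UNIV g"
    have gg': "g (g' y) = y" and ff': "f' (f x) = x" for x y
      using g(2) bf by (auto simp: f'_def g'_def bij_is_surj surj_f_inv_f bij_is_inj)
    obtain h where h: "linear h" "h \<circ> g = id"
      using linear_injective_left_inverse[OF g(1) bij_is_inj[OF g(2)]] by blast
    have "h y = g' y" for y
      using gg'[of y] h(2) by (metis comp_apply id_apply)
    then have "h = g'" by blast
    with h have lin: "linear g'" by simp
    have bij_g': "bij g'"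
      using g(2) by (simp add: g'_def bij_imp_bij_inv)
    have "f' y = g' (- c) + g' y" for y
    proof -
      have "f (g' (- c) + g' y) = y"
        by (simp add: feq linear_add[OF g(1)] gg')
      then show ?thesis by (metis ff')
    qed
    then have "f' = (\<lambda>y. g' (- c) + g' y)" by blast
    then have "affine_transformation f'"
      unfolding affine_transformation_def using lin bij_g' by blast
    moreover have "f' ` P = P"
    proof -
      have "f' ` f ` P = P" by (simp add: image_image ff')
      with f show ?thesis by simp
    qed
    moreover have "(\<lambda>x\<in>UNIV. inv_into UNIV f x) = f'" by (auto simp: f'_def)
    ultimately show "inv\<^bsub>BijGroup UNIV\<^esub> f \<in> {f. affine_transformation f \<and> f ` P = P}"
      using bf by (simp add: inv_BijGroup Bij_UNIV)
  next
    fix f f' :: "'a \<Rightarrow> 'a"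
    assume f: "f \<in> {f. affine_transformation f \<and> f ` P = P}"
      "f' \<in> {f. affine_transformation f \<and> f ` P = P}"
    then obtain c g c' g' where g: "linear g" "bij g" "f = (\<lambda>x. c + g x)"
      "linear g'" "bij g'" "f' = (\<lambda>x. c' + g' x)"
      unfolding affine_transformation_def by blast
    have "f \<circ> f' = (\<lambda>x. (c + g c') + (g \<circ> g') x)"
      using g by (auto simp: linear_add)
    moreover have "linear (g \<circ> g')" "bij (g \<circ> g')" using g by (auto intro: linear_compose bij_comp)
    ultimately have "affine_transformation (f \<circ> f')"
      unfolding affine_transformation_def by blast
    moreover have "(f \<circ> f') ` P = P" using f by (metis (mono_tags, lifting) image_comp mem_Collect_eq)
    moreover have "f \<otimes>\<^bsub>BijGroup UNIV\<^esub> f' = f \<circ> f'"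
      using f bij by (auto simp: BijGroup_def Bij_UNIV compose_def)
    ultimately show "f \<otimes>\<^bsub>BijGroup UNIV\<^esub> f' \<in> {f. affine_transformation f \<and> f ` P = P}" by simp
  qed
  then show ?thesis
    unfolding geom_symmetry_group_def by (rule B.subgroup_imp_group)
qed

lemma induced_symmetry_in_comb_symmetry_group:
  assumes "f \<in> carrier (geom_symmetry_group P)"
  shows "induced_symmetry P f \<in> carrier (comb_symmetry_group (face_lattice P))"
proof -
  have "affine_transformation f" and fP: "f ` P = P"
    using assms by (auto simp: geom_symmetry_group_def)
  then obtain c g where g: "linear g" "bij g" and feq: "f = (\<lambda>x. c + g x)"
    unfolding affine_transformation_def by blast
  have "inj f"
    using bij_is_inj[OF g(2)] by (auto simp: feq inj_def)
  have image: "f ` S = (+) c ` g ` S" for S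
    by (simp add: feq image_image)
  have face: "f ` F face_of P \<longleftrightarrow> F face_of P" for F
  proof -
    have "f ` F face_of f ` P \<longleftrightarrow> g ` F face_of g ` P"
      unfolding image by (rule face_of_translation_eq)
    also have "\<dots> \<longleftrightarrow> F face_of P"
      by (rule face_of_linear_image[OF g(1) bij_is_inj[OF g(2)]])
    finally show ?thesis by (simp add: fP)
  qed
  have surj: "surj f"
  proof -
    have "surj g" using g(2) by (rule bij_is_surj)
    have "\<exists>x. y = f x" for y
    proof -
      obtain x where "y - c = g x" using \<open>surj g\<close> by (metis surjD)
      then have "y = f x" by (simp add: feq algebra_simps)
      then show ?thesis by blast
    qed
    then show ?thesis by (auto simp: surj_def)
  qed
  have "bij_betw ((`) f) (face_lattice P) (face_lattice P)"
  proof (rule bij_betw_imageI)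
    show "inj_on ((`) f) (face_lattice P)"
      by (simp add: inj_on_def inj_image_eq_iff[OF \<open>inj f\<close>])
    show "(`) f ` face_lattice P = face_lattice P"
    proof
      show "(`) f ` face_lattice P \<subseteq> face_lattice P"
        by (auto simp: face_lattice_def face)
      show "face_lattice P \<subseteq> (`) f ` face_lattice P"
      proof
        fix F assume F: "F \<in> face_lattice P"
        have eq: "f ` (f -` F) = F" by (rule surj_image_vimage_eq[OF surj])
        with F face[of "f -` F"] have "f -` F \<in> face_lattice P"
          by (simp add: face_lattice_def)
        with eq show "F \<in> (`) f ` face_lattice P" by (metis imageI)
      qed
    qed
  qed
  then have "bij_betw (induced_symmetry P f) (face_lattice P) (face_lattice P)"
    by (simp add: induced_symmetry_def)
  then show ?thesis
    by (simp add: comb_symmetry_group_def inclusion_iso_def Bij_def induced_symmetry_def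
        inj_image_subset_iff[OF \<open>inj f\<close>])
qed

end

theory Submission
  imports Defs
begin

text \<open>
  Centre a realisation at the barycentre of its vertices. A flag shows that it spans at most four
  dimensions, so the two commuting rotations split the space into two invariant planes: the \<open>v'\<^sub>i\<close>
  lie in the first, the \<open>v''\<^sub>j\<close> in the second, and \<open>v\<^sub>i\<^sub>j = x\<^sub>i + y\<^sub>j\<close>. For an invariant inner product
  the \<open>v'\<^sub>i\<close> turn by a fixed angle \<open>\<phi>\<close>, with \<open>m\<phi> \<le> 2\<pi>\<close> by convexity, and \<open>x\<^sub>i\<close> lies on the line through
  \<open>v'\<^sub>i\<^sub>-\<^sub>1\<close> and \<open>v'\<^sub>i\<close>. A functional that equals 1 on the facet with apices \<open>v'\<^sub>i\<close> and \<open>v''\<^sub>j\<close> takes equal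
  values at \<open>x\<^sub>i\<close> and \<open>x\<^sub>i\<^sub>+\<^sub>1\<close>, which forces this value to be at least \<open>cos\<^sup>2 (\<phi>/2)\<close>. With the angle \<open>\<theta>\<close> of the
  other factor, \<open>cos\<^sup>2 (\<phi>/2) + cos\<^sup>2 (\<theta>/2) \<le> 1\<close>, so \<open>\<phi> + \<theta> \<ge> \<pi>\<close> and \<open>1/m + 1/n \<ge> 1/2\<close>.
\<close>

section \<open>Cyclic orbits in a plane\<close>

lemma sum_cyclic_shift:
  fixes s :: "nat \<Rightarrow> 'a::cancel_comm_monoid_add"
  assumes "\<And>k. s (k + m) = s k"
  shows "(\<Sum>k<m. s (k + i)) = (\<Sum>k<m. s k)"
proof (induction i)
  case (Suc i)
  \<comment> \<open>Adding \<open>s i\<close> on both sides avoids subtraction, as the codomain is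
    only a cancellative monoid.\<close>
  have "s i + (\<Sum>k<m. s (Suc k + i)) = s i + (\<Sum>k<m. s (k + i))"
    using sum.lessThan_Suc_shift[of "\<lambda>k. s (k + i)" m] assms[of i]
    by (simp add: add.commute)
  with Suc show ?case by simp
qed simp

text \<open>For \<open>t\<close> equal to 1 or -1, a positive left side compares the averaged inner
  product at lag \<open>i\<close> with the one at lag 0.\<close>

lemma sum_cyclic_polarization:
  fixes a :: "nat \<Rightarrow> 'a::real_inner"
  assumes "\<And>k. a (k + m) = a k"
  shows "(\<Sum>k<m. (norm (a k + t *\<^sub>R a (k + i)))\<^sup>2) =
    (1 + t\<^sup>2) * (\<Sum>k<m. a k \<bullet> a k) + 2 * t * (\<Sum>k<m. a k \<bullet> a (k + i))"
proof -
  have "(\<Sum>k<m. a (k + i) \<bullet> a (k + i)) = (\<Sum>k<m. a k \<bullet> a k)"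
    by (rule sum_cyclic_shift) (simp add: assms)
  moreover have "(norm (a k + t *\<^sub>R a (k + i)))\<^sup>2 =
      a k \<bullet> a k + 2 * t * (a k \<bullet> a (k + i)) + t\<^sup>2 * (a (k + i) \<bullet> a (k + i))" for k
    unfolding power2_norm_eq_inner power2_eq_square[of t] inner_add_left inner_add_right
      inner_scaleR_left inner_scaleR_right inner_commute[of "a (k + i)" "a k"]
    by (simp only: algebra_simps mult_2)
  ultimately show ?thesis
    by (simp add: sum.distrib sum_distrib_left[symmetric] algebra_simps)
qed

text \<open>In the inner product averaged over the cyclic shift, the shift is an isometry.\<close>
lemma cyclic_planar_recurrence:
  fixes a :: "nat \<Rightarrow> 'a::real_inner"
  assumes per: "\<And>k. a (k + m) = a k"
    and m: "m > 0"
    and rec: "\<And>k. a (k + 2) = p *\<^sub>R a (k + 1) + q *\<^sub>R a k"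
    and "a 0 \<noteq> a 2" "a 0 \<noteq> a 1" "a 0 + a 1 \<noteq> 0"
  shows "q = -1" "\<bar>p\<bar> < 2"
proof -
  \<comment> \<open>Up to the factor \<open>m\<close>, \<open>Q i\<close> is the averaged inner
    product of \<open>a 0\<close> and \<open>a i\<close>; it does not change when both indices are
    shifted.\<close>
  define Q where "Q i = (\<Sum>k<m. a k \<bullet> a (k + i))" for i
  have pos: "0 < (1 + t\<^sup>2) * Q 0 + 2 * t * Q i" if "a 0 + t *\<^sub>R a i \<noteq> 0" for t i
  proof -
    have "0 < (\<Sum>k<m. (norm (a k + t *\<^sub>R a (k + i)))\<^sup>2)"
      by (rule sum_pos2[where i = 0]) (use that m in auto)
    also have "\<dots> = (1 + t\<^sup>2) * Q 0 + 2 * t * Q i"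
      unfolding Q_def using sum_cyclic_polarization[of a m t i] per by simp
    finally show ?thesis .
  qed
  have shift: "(\<Sum>k<m. a (k + j) \<bullet> a (k + j + i)) = Q i" for i j
    unfolding Q_def
    using sum_cyclic_shift[of "\<lambda>k. a k \<bullet> a (k + i)" m j] per
    by (metis (no_types, lifting) add.commute add.left_commute sum.cong)
  \<comment> \<open>This relation and the next two pair the recurrence with \<open>a k\<close>,
    \<open>a (k + 2)\<close> and \<open>a (k + 1)\<close> in turn.\<close>
  have "Q 2 = p * Q 1 + q * Q 0"
    unfolding Q_def rec by (simp add: inner_add_right sum.distrib sum_distrib_left)
  moreover have "Q 0 = p * Q 1 + q * Q 2"
  proof -
    have "Q 0 = (\<Sum>k<m. a (k + 2) \<bullet> a (k + 2))"
      using shift[of 2 0] by simp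
    also have "\<dots> = (\<Sum>k<m. p * (a (k + 1) \<bullet> a (k + 1 + 1)) + q * (a k \<bullet> a (k + 2)))"
      by (subst (1) rec) (simp add: inner_add_left)
    finally show ?thesis
      using shift[of 1 1] by (simp add: sum.distrib sum_distrib_left[symmetric] Q_def)
  qed
  moreover have "Q 1 = p * Q 0 + q * Q 1"
  proof -
    have "Q 1 = (\<Sum>k<m. a (k + 1) \<bullet> a (k + 2))"
      using shift[of 1 1] by (simp add: numeral_2_eq_2)
    also have "\<dots> = (\<Sum>k<m. p * (a (k + 1) \<bullet> a (k + 1)) + q * (a k \<bullet> a (k + 1)))"
      by (subst rec) (simp add: inner_add_right inner_commute)
    finally show ?thesis
      using shift[of 1 0] by (simp add: sum.distrib sum_distrib_left[symmetric] Q_def)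
  qed
  \<comment> \<open>Strict Cauchy-Schwarz inequalities for vectors of equal averaged length, one for
    each non-degeneracy hypothesis.\<close>
  moreover have "Q 2 < Q 0" "Q 1 < Q 0" "- Q 0 < Q 1"
    using pos[of "-1" 2] pos[of "-1" 1] pos[of 1 1] assms(4-6) by auto
  ultimately show q: "q = -1" and "\<bar>p\<bar> < 2"
  proof -
    assume *: "Q 2 = p * Q 1 + q * Q 0" "Q 0 = p * Q 1 + q * Q 2" "Q 1 = p * Q 0 + q * Q 1"
      "Q 2 < Q 0" "Q 1 < Q 0" "- Q 0 < Q 1"
    \<comment> \<open>Comparing the first two relations gives \<open>q = -1\<close>; the third then
      makes \<open>p\<close> twice the cosine \<open>Q 1 / Q 0\<close>.\<close>
    have "(Q 2 - Q 0) * (1 + q) = 0" using *(1,2) by (simp add: algebra_simps)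
    with *(4) show "q = -1" by simp
    with *(3) have "2 * Q 1 = p * Q 0" by simp
    then have "\<bar>p\<bar> * Q 0 = \<bar>2 * Q 1\<bar>" using *(5,6) by (simp add: abs_mult)
    also have "\<dots> < 2 * Q 0" using *(5,6) by auto
    finally show "\<bar>p\<bar> < 2" using *(5,6) by simp
  qed
qed

text \<open>
  The hypothesis on \<open>t\<close> says that the turning angle \<open>\<phi>\<close> never lands strictly within \<open>\<phi>/2\<close> of the
  starting direction; a step of length \<open>\<phi>\<close> cannot jump over that window.
\<close>
lemma turning_angle_le:
  fixes t :: "nat \<Rightarrow> real" and \<phi> h :: real
  assumes phi: "0 < \<phi>" "\<phi> < pi" and m: "m \<ge> 3"
    and rec: "\<And>k. t (k + 2) = 2 * cos \<phi> * t (k + 1) - t k"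
    and t: "t 0 = h" "t 1 = h" "t m = h" "h > 0"
    and less: "\<And>k. 2 \<le> k \<Longrightarrow> k < m \<Longrightarrow> t k < h"
  shows "real m * \<phi> \<le> 2 * pi"
proof (rule ccontr)
  assume "\<not> ?thesis"
  then have big: "m * \<phi> > 2 * pi" by simp
  have c: "cos (\<phi> / 2) > 0" by (rule cos_gt_zero_pi) (use phi in auto)
  \<comment> \<open>The solution of the recurrence that is symmetric about index 1/2. The factor
    \<open>cos (\<phi> / 2)\<close> avoids a division, and two consecutive values carry the
    second-order induction.\<close>
  have tk: "t k * cos (\<phi> / 2) = h * cos (\<phi> * (k - 1 / 2))
      \<and> t (Suc k) * cos (\<phi> / 2) = h * cos (\<phi> * (k + 1 / 2))" for k
  proof (induction k)
    case 0 then show ?case using t by simp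
  next
    case (Suc k)
    have "cos (\<phi> * (k + 1 / 2) + \<phi>) + cos (\<phi> * (k + 1 / 2) - \<phi>) =
        2 * cos \<phi> * cos (\<phi> * (k + 1 / 2))"
      by (simp add: cos_add cos_diff)
    moreover have "\<phi> * (k + 1 / 2) + \<phi> = \<phi> * (real (Suc k) + 1 / 2)"
      "\<phi> * (k + 1 / 2) - \<phi> = \<phi> * (k - 1 / 2)"
      and eq: "\<phi> * (real (Suc k) - 1 / 2) = \<phi> * (k + 1 / 2)"
      by (simp_all add: algebra_simps)
    ultimately have step: "cos (\<phi> * (real (Suc k) + 1 / 2)) =
        2 * cos \<phi> * cos (\<phi> * (k + 1 / 2)) - cos (\<phi> * (k - 1 / 2))"
      by simp
    have "t (Suc (Suc k)) * cos (\<phi> / 2) =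
        2 * cos \<phi> * (t (Suc k) * cos (\<phi> / 2)) - t k * cos (\<phi> / 2)"
      using arg_cong[OF rec[of k], of "\<lambda>u. u * cos (\<phi> / 2)"] by (simp add: algebra_simps)
    then show ?case
      unfolding step eq using Suc by (simp add: algebra_simps)
  qed
  \<comment> \<open>The first step that passes a full turn. Its phase, less one turn, is the
    \<theta> below and lies within \<phi>/2 of 0, so \<open>t k\<close> is at least \<open>h\<close>
    and only \<open>k = m\<close> remains.\<close>
  define k where "k = (LEAST k::nat. k * \<phi> > 2 * pi)"
  have k: "k * \<phi> > 2 * pi" unfolding k_def by (rule LeastI[of _ m]) (use big in auto)
  have "k \<le> m" unfolding k_def by (rule Least_le) (use big in auto)
  have "k \<ge> 3"
  proof (rule ccontr)
    assume "\<not> 3 \<le> k" then have "real k \<le> 2" by simp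
    then have "k * \<phi> \<le> 2 * \<phi>" using phi by (intro mult_right_mono) auto
    with k phi show False by simp
  qed
  have k1: "(real k - 1) * \<phi> \<le> 2 * pi"
    using not_less_Least[of "k - 1" "\<lambda>k::nat. k * \<phi> > 2 * pi"] \<open>k \<ge> 3\<close>
    by (simp add: k_def[symmetric] of_nat_diff)
  define \<theta> where "\<theta> = \<phi> * (k - 1 / 2) - 2 * pi"
  have \<theta>: "- (\<phi> / 2) < \<theta>" "\<theta> \<le> \<phi> / 2"
    using k k1 by (simp_all add: \<theta>_def algebra_simps)
  have "cos (\<phi> * (k - 1 / 2)) = cos \<theta>"
    unfolding \<theta>_def by (simp add: cos_diff)
  then have tk': "t k * cos (\<phi> / 2) = h * cos \<bar>\<theta>\<bar>" using tk[of k] by (simp add: abs_if)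
  have "cos (\<phi> / 2) \<le> cos \<bar>\<theta>\<bar>" by (rule cos_monotone_0_pi_le) (use \<theta> phi in auto)
  then have "h * cos (\<phi> / 2) \<le> t k * cos (\<phi> / 2)" unfolding tk' using t by simp
  then have "h \<le> t k" using c by simp
  with less[of k] \<open>k \<ge> 3\<close> \<open>k \<le> m\<close> have "k = m" by force
  with tk' t have "cos (\<phi> / 2) = cos \<bar>\<theta>\<bar>" by simp
  moreover have "\<bar>\<theta>\<bar> \<le> pi" "0 \<le> \<phi> / 2" "\<phi> / 2 \<le> pi" using \<theta> phi by linarith+
  ultimately have "\<bar>\<theta>\<bar> = \<phi> / 2" using cos_inj_pi[of "\<bar>\<theta>\<bar>" "\<phi> / 2"] by simp
  with \<theta> have "\<theta> = \<phi> / 2" by linarith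
  \<comment> \<open>In this boundary case \<open>m - 1\<close> steps make exactly one turn, so
    \<open>t (k - 1)\<close> already equals \<open>h\<close>, which \<open>less\<close>
    excludes.\<close>
  then have "\<phi> * (real k - 1) = 2 * pi" by (simp add: \<theta>_def algebra_simps)
  then have "\<phi> * ((k - 1) - 1 / 2) = 2 * pi - \<phi> / 2"
    using \<open>k \<ge> 3\<close> by (simp add: of_nat_diff algebra_simps)
  then have "t (k - 1) * cos (\<phi> / 2) = h * cos (2 * pi - \<phi> / 2)"
    using tk[of "k - 1"] \<open>k \<ge> 3\<close> by (simp add: of_nat_diff)
  then have "t (k - 1) = h" using c by (simp add: cos_diff)
  moreover have "2 \<le> k - 1" "k - 1 < m" using \<open>k \<ge> 3\<close> \<open>k = m\<close> by simp_all
  ultimately show False using less by fastforce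
qed

lemma in_span_pair:
  assumes "z \<in> span {x, y}"
  obtains s t where "z = s *\<^sub>R x + t *\<^sub>R y"
proof -
  obtain s where "z - s *\<^sub>R x \<in> span {y}" using assms by (auto simp: span_breakdown_eq)
  then obtain t where "z - s *\<^sub>R x - t *\<^sub>R y = 0" by (auto simp: span_breakdown_eq)
  then show thesis by (intro that[of s t]) (simp add: algebra_simps)
qed

text \<open>
  \<open>a\<close> is the orbit of the apices in one polygon factor and \<open>x\<close> the projected orbit of the product
  vertices; the parameters \<open>r\<close> and \<open>h\<close> give the line through a side of the polygon \<open>a\<close>, which
  contains \<open>x 1\<close>.
\<close>
lemma rotated_polygon_side:
  fixes a x :: "nat \<Rightarrow> 'a::euclidean_space"
  assumes lin: "linear \<alpha>" and m: "m \<ge> 3"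
    and \<alpha>: "\<And>k. \<alpha> (a k) = a (Suc k)" "\<alpha> (x 1) = x 2"
    and per: "\<And>k. a (k + m) = a k"
    and sum0: "(\<Sum>k<m. a k) = 0"
    and U: "subspace U" "dim U \<le> 2" "\<And>k. a k \<in> U" "x 1 \<in> U"
    and ne: "a 0 \<noteq> a 1"
    and side: "r \<bullet> a 0 = h" "r \<bullet> a 1 = h" "r \<bullet> x 1 = h" "\<And>k. 2 \<le> k \<Longrightarrow> k < m \<Longrightarrow> r \<bullet> a k < h"
  obtains \<phi> :: real where "0 < \<phi>" "\<phi> < pi" "m * \<phi> \<le> 2 * pi"
    "\<forall>l. l \<bullet> a 1 > 0 \<and> l \<bullet> x 1 = l \<bullet> x 2 \<longrightarrow> (l \<bullet> a 1) * (1 + cos \<phi>) / 2 \<le> l \<bullet> x 1"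
proof -
  \<comment> \<open>The vectors \<open>a k\<close> sum to 0, while \<open>r\<close> is at most
    \<open>h\<close> on all of them and below \<open>h\<close> on \<open>a 2\<close>; this forces
    \<open>h > 0\<close>.\<close>
  have "0 < (\<Sum>k<m. h - r \<bullet> a k)"
  proof (rule sum_pos2[where i = 2])
    fix k assume "k \<in> {..<m}"
    show "0 \<le> h - r \<bullet> a k"
      using side(1,2) side(4)[of k] \<open>k \<in> {..<m}\<close>
      by (cases "k = 0"; cases "k = 1") auto
  qed (use m side(4)[of 2] in auto)
  also have "\<dots> = m * h"
    using sum0 by (simp add: sum_subtractf inner_sum_right[symmetric])
  finally have "h > 0" using m by (simp add: zero_less_mult_iff)
  have ind: "a 0 \<notin> span {a 1}"
  proof
    assume "a 0 \<in> span {a 1}"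
    then obtain t where "a 0 = t *\<^sub>R a 1" by (auto simp: span_singleton)
    then have "h = t * h" using side(1,2) by simp
    with \<open>h > 0\<close> \<open>a 0 = t *\<^sub>R a 1\<close> ne show False by simp
  qed
  have "a 1 \<noteq> 0" using side(2) \<open>h > 0\<close> by auto
  have "independent {a 0, a 1}"
    using ind \<open>a 1 \<noteq> 0\<close> by (simp add: independent_insert)
  moreover have "card {a 0, a 1} = 2" using ne by simp
  ultimately have "U \<subseteq> span {a 0, a 1}"
    using U by (intro card_ge_dim_independent) auto
  then have inspan: "\<exists>p q. z = p *\<^sub>R a 1 + q *\<^sub>R a 0" if "z \<in> U" for z
    using in_span_pair[of z "a 1" "a 0"] that by (metis insert_commute subsetD)
  obtain p q where "a 2 = p *\<^sub>R a 1 + q *\<^sub>R a 0" using inspan U by blast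
  \<comment> \<open>Only the case \<open>k = 0\<close> uses the plane; applying \<alpha> moves the
    relation along the orbit with the same coefficients.\<close>
  then have rec: "a (k + 2) = p *\<^sub>R a (k + 1) + q *\<^sub>R a k" for k
  proof (induction k)
    case (Suc k)
    then have "\<alpha> (a (k + 2)) = p *\<^sub>R \<alpha> (a (k + 1)) + q *\<^sub>R \<alpha> (a k)"
      by (simp add: linear_add[OF lin] linear_scale[OF lin])
    then show ?case by (simp add: \<alpha>)
  qed (simp add: numeral_2_eq_2)
  have "a 0 \<noteq> a 2" using side(1) side(4)[of 2] m by auto
  moreover have "a 0 + a 1 \<noteq> 0"
  proof
    assume "a 0 + a 1 = 0"
    then have "r \<bullet> (a 0 + a 1) = 0" by simp
    then show False using side \<open>h > 0\<close> by (simp add: inner_add_right)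
  qed
  ultimately have q: "q = -1" and p: "\<bar>p\<bar> < 2"
    using cyclic_planar_recurrence[OF per _ rec] ne m by auto
  \<comment> \<open>The recurrence is that of a plane rotation with trace \<open>p\<close>, and
    \<phi> is its angle.\<close>
  define \<phi> where "\<phi> = arccos (p / 2)"
  have \<phi>: "0 < \<phi>" "\<phi> < pi" and p_eq: "p = 2 * cos \<phi>"
    using p arccos_lt_bounded[of "p / 2"] by (auto simp: \<phi>_def cos_arccos_abs)
  have rec': "l \<bullet> a (k + 2) = 2 * cos \<phi> * (l \<bullet> a (k + 1)) - l \<bullet> a k" for l k
    unfolding rec by (simp add: inner_add_right inner_diff_right q p_eq)
  have "m * \<phi> \<le> 2 * pi"
    by (rule turning_angle_le[of \<phi> m "\<lambda>k. r \<bullet> a k" h])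
      (use \<phi> m rec' side \<open>h > 0\<close> per[of 0] in auto)
  moreover have "d * (1 + cos \<phi>) / 2 \<le> l \<bullet> x 1"
    if l: "l \<bullet> a 1 = d" "l \<bullet> x 1 = l \<bullet> x 2" "d > 0" for l d
  proof -
    obtain s s' where x1: "x 1 = s *\<^sub>R a 1 + s' *\<^sub>R a 0" using inspan U by blast
    \<comment> \<open>\<open>r\<close> has the same nonzero value at \<open>a 0\<close>,
      \<open>a 1\<close> and \<open>x 1\<close>, so the combination is affine.\<close>
    then have "h = (s + s') * h" using side by (simp add: inner_add_right algebra_simps)
    then have s': "s' = 1 - s" using \<open>h > 0\<close> by simp
    have "x 2 = s *\<^sub>R a 2 + s' *\<^sub>R a 1"
      unfolding \<alpha>(2)[symmetric] x1
      by (simp add: linear_add[OF lin] linear_scale[OF lin] \<alpha>(1) numeral_2_eq_2)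
    define A0 where "A0 = l \<bullet> a 0"
    have A2: "l \<bullet> a 2 = 2 * cos \<phi> * d - A0" using rec'[of l 0] l by (simp add: A0_def numeral_2_eq_2)
    have X1: "l \<bullet> x 1 = s * d + (1 - s) * A0"
      unfolding x1 by (simp only: s' inner_add_right inner_scaleR_right l A0_def)
    moreover have "l \<bullet> x 2 = s * (2 * cos \<phi> * d - A0) + (1 - s) * d"
      unfolding \<open>x 2 = _\<close> by (simp only: s' inner_add_right inner_scaleR_right A2 l)
    \<comment> \<open>The equation is linear in \<open>A0\<close> with total coefficient 1, so it
      can be solved for every \<open>s\<close>.\<close>
    ultimately have A0: "A0 = d * (1 - 2 * s + 2 * s * cos \<phi>)"
      using l(2) by (simp add: algebra_simps)
    \<comment> \<open>The excess is a nonnegative multiple of a square, which vanishes when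
      \<open>x 1\<close> is the midpoint of the side.\<close>
    have "l \<bullet> x 1 - d * (1 + cos \<phi>) / 2 = d * (1 - cos \<phi>) * (2 * s - 1)\<^sup>2 / 2"
      unfolding X1 A0 by (simp add: power2_eq_square field_simps)
    also have "\<dots> \<ge> 0" using l(3) by simp
    finally show ?thesis by simp
  qed
  ultimately show thesis using \<phi> by (intro that[of \<phi>]) blast+
qed

section \<open>Two complementary planes\<close>

text \<open>\<open>r\<close> vanishes on \<open>y - x\<close> and is negative on
  \<open>z - x\<close>, so the two differences are independent.\<close>

lemma dim_span_two_differences:
  assumes "r \<bullet> x = h" "r \<bullet> y = h" "r \<bullet> z < h" "x \<noteq> y"
  shows "dim (span {y - x, z - x}) = 2"
proof -
  have "z - x \<notin> span {y - x}"
  proof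
    assume "z - x \<in> span {y - x}"
    then obtain t where t: "z - x = t *\<^sub>R (y - x)" by (auto simp: span_singleton)
    have "r \<bullet> (z - x) = t * (r \<bullet> (y - x))" unfolding t by simp
    with assms show False by (simp add: inner_diff_right)
  qed
  moreover from this have "z - x \<noteq> y - x" by (metis insertI1 span_base)
  ultimately have "independent {z - x, y - x}" "card {z - x, y - x} = 2"
    using assms(4) by (auto simp: independent_insert)
  then show ?thesis
    by (metis dim_eq_card_independent dim_span insert_commute)
qed

lemma linear_sum_funpow:
  fixes \<alpha> :: "'a::real_vector \<Rightarrow> 'a"
  assumes "linear \<alpha>"
  shows "linear (\<lambda>u. \<Sum>k<m. (\<alpha> ^^ k) u)"
proof (rule linear_compose_sum, rule ballI)
  fix k show "linear (\<alpha> ^^ k)"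
    using linear_id linear_compose[OF _ assms] by (induction k) (auto simp: o_def)
qed

text \<open>Isolates the linear data of a symmetric realisation, with periodic natural indices in
  place of residues. \<open>row\<close> and \<open>col\<close> bound the two angles from above, and
  the single facet in \<open>cell\<close> bounds their sum from below.\<close>

lemma two_rotations_bound:
  fixes \<alpha> \<beta> :: "'a::euclidean_space \<Rightarrow> 'a" and v :: "nat \<Rightarrow> nat \<Rightarrow> 'a" and a b :: "nat \<Rightarrow> 'a"
  assumes mn: "m \<ge> 3" "n \<ge> 3"
    and lin: "linear \<alpha>" "linear \<beta>"
    and \<alpha>: "\<And>i. \<alpha> (a i) = a (Suc i)" "\<And>j. \<alpha> (b j) = b j" "\<And>i j. \<alpha> (v i j) = v (Suc i) j"
    and \<beta>: "\<And>i. \<beta> (a i) = a i" "\<And>j. \<beta> (b j) = b (Suc j)" "\<And>i j. \<beta> (v i j) = v i (Suc j)"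
    and per: "\<And>i. a (i + m) = a i" "\<And>j. b (j + n) = b j"
      "\<And>i j. v (i + m) j = v i j" "\<And>i j. v i (j + n) = v i j"
    and D: "subspace D" "dim D \<le> 4" "\<And>i. a i \<in> D" "\<And>j. b j \<in> D" "\<And>i j. v i j \<in> D"
    and row: "\<And>i. \<exists>r h. (\<forall>j. r \<bullet> v (Suc i) j = h) \<and> r \<bullet> a i = h \<and> r \<bullet> a (Suc i) = h \<and>
      (\<forall>k. i + 2 \<le> k \<and> k < i + m \<longrightarrow> r \<bullet> a k < h)"
    and col: "\<And>j. \<exists>r h. (\<forall>i. r \<bullet> v i (Suc j) = h) \<and> r \<bullet> b j = h \<and> r \<bullet> b (Suc j) = h \<and>
      (\<forall>k. j + 2 \<le> k \<and> k < j + n \<longrightarrow> r \<bullet> b k < h)"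
    and cell: "\<exists>r h. r \<bullet> v 1 1 = h \<and> r \<bullet> v 2 1 = h \<and> r \<bullet> v 1 2 = h \<and> r \<bullet> a 1 = h \<and> r \<bullet> b 1 = h \<and>
      (\<forall>k. r \<bullet> a k \<le> h) \<and> r \<bullet> a 0 < h"
  shows "m * n \<le> 2 * (m + n)"
proof -
  \<comment> \<open>Orbit sums: \<open>SB\<close> multiplies every \<open>a i\<close> by
    \<open>n\<close> and takes a common value on the \<open>b j\<close>; \<open>SA\<close> does the
    reverse. Rescaled, they become the two projections.\<close>
  define SA where "SA u = (\<Sum>k<m. (\<alpha> ^^ k) u)" for u
  define SB where "SB u = (\<Sum>k<n. (\<beta> ^^ k) u)" for u
  have S_lin: "linear SA" "linear SB"
    unfolding SA_def SB_def using lin by (auto intro: linear_sum_funpow)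
  have funpow: "(\<alpha> ^^ k) (a i) = a (i + k)" "(\<alpha> ^^ k) (b j) = b j" "(\<alpha> ^^ k) (v i j) = v (i + k) j"
    "(\<beta> ^^ k) (a i) = a i" "(\<beta> ^^ k) (b j) = b (j + k)" "(\<beta> ^^ k) (v i j) = v i (j + k)" for i j k
    by (induction k) (simp_all add: \<alpha> \<beta>)
  have SA: "SA (a i) = (\<Sum>k<m. a k)" "SA (b j) = m *\<^sub>R b j" "SA (v i j) = (\<Sum>k<m. v k j)" for i j
    using sum_cyclic_shift[of a m i] sum_cyclic_shift[of "\<lambda>k. v k j" m i] per
    by (simp_all add: SA_def funpow add.commute scaleR_conv_of_real of_nat_def sum_constant_scaleR)
  have SB: "SB (a i) = n *\<^sub>R a i" "SB (b j) = (\<Sum>k<n. b k)" "SB (v i j) = (\<Sum>k<n. v i k)" for i j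
    using sum_cyclic_shift[of b n j] sum_cyclic_shift[of "\<lambda>k. v i k" n j] per
    by (simp_all add: SB_def funpow add.commute sum_constant_scaleR)
  obtain r0 h0 where r0: "\<forall>j. r0 \<bullet> v 1 j = h0" "r0 \<bullet> a 0 = h0" "r0 \<bullet> a 1 = h0"
    "\<forall>k. 2 \<le> k \<and> k < m \<longrightarrow> r0 \<bullet> a k < h0"
    using row[of 0] by auto
  obtain s0 g0 where s0: "\<forall>i. s0 \<bullet> v i 1 = g0" "s0 \<bullet> b 0 = g0" "s0 \<bullet> b 1 = g0"
    "\<forall>k. 2 \<le> k \<and> k < n \<longrightarrow> s0 \<bullet> b k < g0"
    using col[of 0] by auto
  \<comment> \<open>The functional of the next side separates \<open>a 1\<close> from
    \<open>a m\<close>, which is \<open>a 0\<close>; \<open>m \<ge> 3\<close> puts the index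
    \<open>m\<close> into its window.\<close>
  have a01: "a 0 \<noteq> a 1"
  proof -
    obtain r h where "r \<bullet> a 1 = h" "\<forall>k. 3 \<le> k \<and> k < Suc m \<longrightarrow> r \<bullet> a k < h"
      using row[of 1] by (auto simp: numeral_3_eq_3)
    then have "r \<bullet> a m < r \<bullet> a 1" using mn by auto
    then show ?thesis using per(1)[of 0] by auto
  qed
  have b01: "b 0 \<noteq> b 1"
  proof -
    obtain r h where "r \<bullet> b 1 = h" "\<forall>k. 3 \<le> k \<and> k < Suc n \<longrightarrow> r \<bullet> b k < h"
      using col[of 1] by (auto simp: numeral_3_eq_3)
    then have "r \<bullet> b n < r \<bullet> b 1" using mn by auto
    then show ?thesis using per(2)[of 0] by auto
  qed
  \<comment> \<open>\<open>SA (a i)\<close> does not depend on \<open>i\<close>, so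
    \<open>SA\<close> kills differences even before the orbit sum is known to be 0.\<close>
  define U where "U = span {a 1 - a 0, a 2 - a 0}"
  define W where "W = span {b 1 - b 0, b 2 - b 0}"
  have dimU: "dim U = 2"
    unfolding U_def by (rule dim_span_two_differences[of r0 _ h0]) (use r0 a01 mn in auto)
  have dimW: "dim W = 2"
    unfolding W_def by (rule dim_span_two_differences[of s0 _ g0]) (use s0 b01 mn in auto)
  have sub: "subspace U" "subspace W" by (simp_all add: U_def W_def)
  have U: "SA u = 0 \<and> SB u = n *\<^sub>R u" if "u \<in> U" for u
  proof
    show "SA u = 0"
      by (rule linear_eq_on_span[OF S_lin(1) linear_zero _ that[unfolded U_def]])
        (auto simp: linear_diff[OF S_lin(1)] SA)
    show "SB u = n *\<^sub>R u"
      by (rule linear_eq_on_span[OF S_lin(2) linear_scale_self _ that[unfolded U_def]])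
        (auto simp: linear_diff[OF S_lin(2)] SB scaleR_diff_right)
  qed
  have W: "SB u = 0 \<and> SA u = m *\<^sub>R u" if "u \<in> W" for u
  proof
    show "SB u = 0"
      by (rule linear_eq_on_span[OF S_lin(2) linear_zero _ that[unfolded W_def]])
        (auto simp: linear_diff[OF S_lin(2)] SB)
    show "SA u = m *\<^sub>R u"
      by (rule linear_eq_on_span[OF S_lin(1) linear_scale_self _ that[unfolded W_def]])
        (auto simp: linear_diff[OF S_lin(1)] SA scaleR_diff_right)
  qed
  have "U \<inter> W = {0}"
  proof -
    have "u = 0" if "u \<in> U" "u \<in> W" for u
      using U[OF that(1)] W[OF that(2)] mn by simp
    then show ?thesis using subspace_0[OF sub(1)] subspace_0[OF sub(2)] by blast
  qed
  \<comment> \<open>Two planes that meet only in 0 fill \<open>D\<close>, whose dimension is at most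
    4.\<close>
  then have "dim {x + y |x y. x \<in> U \<and> y \<in> W} = 4"
    using dim_sums_Int[OF sub] dimU dimW by simp
  moreover have "{a 1 - a 0, a 2 - a 0} \<subseteq> D" "{b 1 - b 0, b 2 - b 0} \<subseteq> D"
    using D by (auto intro: subspace_diff)
  then have "U \<subseteq> D" "W \<subseteq> D"
    unfolding U_def W_def using D(1) by (simp_all add: span_minimal)
  then have "{x + y |x y. x \<in> U \<and> y \<in> W} \<subseteq> D"
    using subspace_add[OF D(1)] by blast
  ultimately have D_eq: "{x + y |x y. x \<in> U \<and> y \<in> W} = D"
    using D(1,2) subspace_sums[OF sub] by (intro subspace_dim_equal) simp_all
  have split: "z = (1 / n) *\<^sub>R SB z + (1 / m) *\<^sub>R SA z" "SA (SB z) = 0" "SB (SA z) = 0"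
    "(1 / n) *\<^sub>R SB z \<in> U" "(1 / m) *\<^sub>R SA z \<in> W" if z: "z \<in> D" for z
  proof -
    obtain x y where xy: "z = x + y" "x \<in> U" "y \<in> W" using z unfolding D_eq[symmetric] by blast
    then have "SA z = m *\<^sub>R y" "SB z = n *\<^sub>R x"
      using U W by (simp_all add: linear_add[OF S_lin(1)] linear_add[OF S_lin(2)])
    then show "z = (1 / n) *\<^sub>R SB z + (1 / m) *\<^sub>R SA z" "SA (SB z) = 0" "SB (SA z) = 0"
      "(1 / n) *\<^sub>R SB z \<in> U" "(1 / m) *\<^sub>R SA z \<in> W"
      using xy U W mn by (simp_all add: linear_scale[OF S_lin(1)] linear_scale[OF S_lin(2)])
  qed
  \<comment> \<open>\<open>SA (SB (a 0))\<close> is \<open>n\<close> times the orbit sum of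
    \<open>a\<close>, and it vanishes by the splitting; the sum of \<open>b\<close> is treated
    likewise.\<close>
  have sum0: "(\<Sum>k<m. a k) = 0" "(\<Sum>k<n. b k) = 0"
    using split(2)[OF D(3), of 0] split(3)[OF D(4), of 0] mn
    by (simp_all add: SA SB linear_scale[OF S_lin(1)] linear_scale[OF S_lin(2)])
  have aU: "a i \<in> U" for i
    using split(4)[OF D(3), of i] mn by (simp add: SB)
  have bW: "b i \<in> W" for i
    using split(5)[OF D(4), of i] mn by (simp add: SA)
  \<comment> \<open>The components of \<open>v i j\<close> in \<open>U\<close> and \<open>W\<close>:
    each is an average over one index and depends only on the other.\<close>
  define x where "x i = (1 / n) *\<^sub>R (\<Sum>k<n. v i k)" for i
  define y where "y j = (1 / m) *\<^sub>R (\<Sum>k<m. v k j)" for j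
  have v: "v i j = x i + y j" for i j
    using split(1)[OF D(5), of i j] by (simp add: x_def y_def SA SB)
  have xU: "x i \<in> U" and yW: "y j \<in> W" for i j
    using split(4,5)[OF D(5), of i j] by (simp_all add: x_def y_def SA SB)
  have \<alpha>x: "\<alpha> (x 1) = x 2" and \<beta>y: "\<beta> (y 1) = y 2"
    by (simp_all add: x_def y_def linear_scale[OF lin(1)] linear_scale[OF lin(2)]
        linear_sum[OF lin(1)] linear_sum[OF lin(2)] \<alpha> \<beta> numeral_2_eq_2)
  have rx: "r0 \<bullet> x 1 = h0" and sy: "s0 \<bullet> y 1 = g0"
    using r0(1) s0(1) mn by (simp_all add: x_def y_def inner_sum_right)
  obtain r h where cell: "r \<bullet> v 1 1 = h" "r \<bullet> v 2 1 = h" "r \<bullet> v 1 2 = h" "r \<bullet> a 1 = h" "r \<bullet> b 1 = h"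
    "\<forall>k. r \<bullet> a k \<le> h" "r \<bullet> a 0 < h"
    using cell by blast
  have "0 < (\<Sum>k<m. h - r \<bullet> a k)"
    by (rule sum_pos2[where i = 0]) (use mn cell in auto)
  also have "\<dots> = m * h"
    using sum0 by (simp add: sum_subtractf inner_sum_right[symmetric])
  finally have h: "h > 0" using mn by (simp add: zero_less_mult_iff)
  \<comment> \<open>\<open>v 1 1\<close> and \<open>v 2 1\<close> differ only in the first
    component, \<open>v 1 1\<close> and \<open>v 1 2\<close> only in the second.\<close>
  have eq: "r \<bullet> x 1 = r \<bullet> x 2" "r \<bullet> y 1 = r \<bullet> y 2" and sum_eq: "r \<bullet> x 1 + r \<bullet> y 1 = h"
    using cell(1-3) by (simp_all add: v inner_add_right)
  obtain \<phi> :: real where \<phi>: "0 < \<phi>" "\<phi> < pi" "m * \<phi> \<le> 2 * pi"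
    and x: "\<forall>l. l \<bullet> a 1 > 0 \<and> l \<bullet> x 1 = l \<bullet> x 2 \<longrightarrow> (l \<bullet> a 1) * (1 + cos \<phi>) / 2 \<le> l \<bullet> x 1"
    by (rule rotated_polygon_side[of \<alpha> m a x U r0 h0, OF lin(1) mn(1) \<alpha>(1) \<alpha>x per(1) sum0(1) sub(1)
          eq_refl[OF dimU] aU xU a01 r0(2,3) rx r0(4)[rule_format, OF conjI]])
  obtain \<theta> :: real where \<theta>: "0 < \<theta>" "\<theta> < pi" "n * \<theta> \<le> 2 * pi"
    and y: "\<forall>l. l \<bullet> b 1 > 0 \<and> l \<bullet> y 1 = l \<bullet> y 2 \<longrightarrow> (l \<bullet> b 1) * (1 + cos \<theta>) / 2 \<le> l \<bullet> y 1"
    by (rule rotated_polygon_side[of \<beta> n b y W s0 g0, OF lin(2) mn(2) \<beta>(2) \<beta>y per(2) sum0(2) sub(2)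
          eq_refl[OF dimW] bW yW b01 s0(2,3) sy s0(4)[rule_format, OF conjI]])
  \<comment> \<open>The lower bounds for \<open>r\<close> at \<open>x 1\<close> and
    \<open>y 1\<close> are added; the two values sum to \<open>h\<close>.\<close>
  have "h * (cos \<phi> + cos \<theta>) \<le> 0"
    using x[rule_format, of r] y[rule_format, of r] cell(4,5) eq h sum_eq by (simp add: algebra_simps)
  then have "cos \<phi> + cos \<theta> \<le> 0" using h by (simp add: mult_le_0_iff)
  have "pi \<le> \<phi> + \<theta>"
  proof (rule ccontr)
    assume "\<not> ?thesis"
    then have "cos (pi - \<theta>) < cos \<phi>"
      using \<phi> \<theta> by (intro cos_monotone_0_pi) auto
    with \<open>cos \<phi> + cos \<theta> \<le> 0\<close> show False by simp
  qed
  then have "real (m * n) * pi \<le> m * n * (\<phi> + \<theta>)" by (intro mult_left_mono) auto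
  also have "\<dots> = n * (m * \<phi>) + m * (n * \<theta>)" by (simp add: algebra_simps)
  also have "\<dots> \<le> n * (2 * pi) + m * (2 * pi)"
    using \<phi> \<theta> by (intro add_mono mult_left_mono) auto
  also have "\<dots> = real (2 * (m + n)) * pi" by (simp add: algebra_simps)
  finally show ?thesis by (simp only: mult_le_cancel_right_pos[OF pi_gt_zero] of_nat_le_iff)
qed

section \<open>Realisations of face lattices\<close>

text \<open>An order isomorphism says nothing about points, so they are recovered from minimal
  nonempty faces: an extreme point of a face is itself a face of \<open>P\<close> and comes from a
  singleton. Each face is then the hull of its extreme points.\<close>

lemma realization_points:
  fixes P :: "'a::euclidean_space set"
  assumes P: "polytope P" and iso: "inclusion_iso \<psi> L (face_lattice P)"
    and L: "{} \<in> L" "\<And>v. v \<in> \<Omega> \<Longrightarrow> {v} \<in> L" "\<And>X. X \<in> L \<Longrightarrow> X \<subseteq> \<Omega>"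
  obtains p where "\<And>v. v \<in> \<Omega> \<Longrightarrow> \<psi> {v} = {p v}"
    "\<And>X. X \<in> L \<Longrightarrow> \<psi> X = convex hull (p ` X)"
    "\<And>X v. X \<in> L \<Longrightarrow> v \<in> \<Omega> \<Longrightarrow> p v \<in> \<psi> X \<longleftrightarrow> v \<in> X"
proof -
  have bij: "bij_betw \<psi> L (face_lattice P)"
    and mono: "\<And>X Y. X \<in> L \<Longrightarrow> Y \<in> L \<Longrightarrow> \<psi> X \<subseteq> \<psi> Y \<longleftrightarrow> X \<subseteq> Y"
    using iso by (auto simp: inclusion_iso_def)
  have face: "\<psi> X face_of P" if "X \<in> L" for X
    using bij_betw_apply[OF bij that] by (simp add: face_lattice_def)
  have ex: "\<exists>X\<in>L. \<psi> X = F" if "F face_of P" for F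
  proof -
    have "F \<in> \<psi> ` L" using that bij_betw_imp_surj_on[OF bij] by (simp add: face_lattice_def)
    then show ?thesis by blast
  qed
  have empty: "\<psi> {} = {}"
    using ex[of "{}"] mono[OF L(1)] by fastforce
  have nonempty: "\<psi> X \<noteq> {}" if "X \<in> L" "X \<noteq> {}" for X
    using mono[OF that(1) L(1)] that(2) empty by auto
  have extreme_vertex: "\<exists>v\<in>X. \<psi> {v} = {x}" if "X \<in> L" "x extreme_point_of \<psi> X" for X x
  proof -
    have "{x} face_of P"
      using that face face_of_trans face_of_singleton by metis
    then obtain Y where Y: "Y \<in> L" "\<psi> Y = {x}" using ex by blast
    then have "Y \<noteq> {}" using empty by auto
    then obtain v where v: "v \<in> Y" by blast
    then have vL: "{v} \<in> L" using L Y by blast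
    then have "\<psi> {v} \<subseteq> {x}" using mono[OF vL Y(1)] v Y(2) by simp
    then have "\<psi> {v} = {x}" using nonempty[OF vL] by blast
    moreover have "v \<in> X"
      using mono[OF vL that(1)] that(2) \<open>\<psi> {v} = {x}\<close> by (simp add: extreme_point_of_def)
    ultimately show ?thesis by blast
  qed
  have polytope: "polytope (\<psi> X)" if "X \<in> L" for X
    using face_of_polytope_polytope[OF P face[OF that]] .
  have singleton: "\<exists>x. \<psi> {v} = {x}" if "v \<in> \<Omega>" for v
  proof -
    have "{v} \<in> L" using L that by blast
    then obtain x where "x extreme_point_of \<psi> {v}"
      using extreme_point_exists_convex polytope nonempty
      by (metis insert_not_empty polytope_imp_compact polytope_imp_convex)
    then show ?thesis using extreme_vertex \<open>{v} \<in> L\<close> by blast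
  qed
  define p where "p v = the_elem (\<psi> {v})" for v
  have p: "\<psi> {v} = {p v}" if "v \<in> \<Omega>" for v
  proof -
    obtain x where "\<psi> {v} = {x}" using singleton[OF \<open>v \<in> \<Omega>\<close>] by blast
    then show ?thesis by (simp add: p_def)
  qed
  have p_in: "p v \<in> \<psi> X \<longleftrightarrow> v \<in> X" if "X \<in> L" "v \<in> \<Omega>" for X v
    using mono[OF L(2)[OF \<open>v \<in> \<Omega>\<close>] \<open>X \<in> L\<close>] unfolding p[OF \<open>v \<in> \<Omega>\<close>] by blast
  have hull: "\<psi> X = convex hull (p ` X)" if X: "X \<in> L" for X
  proof
    have "{x. x extreme_point_of \<psi> X} \<subseteq> p ` X"
      using extreme_vertex[OF X] p L(3)[OF X] by fastforce
    then show "\<psi> X \<subseteq> convex hull (p ` X)"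
      using Krein_Milman_Minkowski[of "\<psi> X"] polytope[OF X] hull_mono
      by (metis polytope_imp_compact polytope_imp_convex)
    show "convex hull (p ` X) \<subseteq> \<psi> X"
      using p_in[OF X] L(3)[OF X] polytope_imp_convex[OF polytope[OF X]]
      by (intro hull_minimal) auto
  qed
  show thesis by (rule that[of p, OF p hull p_in])
qed

text \<open>A proper nonempty face lies in a facet of \<open>\<psi> Y\<close>, which comes from an
  element of \<open>L\<close> between \<open>X\<close> and \<open>Y\<close>. Covering identifies it
  with \<open>\<psi> X\<close>, and facets have codimension one.\<close>

lemma aff_dim_cover:
  fixes P :: "'a::euclidean_space set"
  assumes P: "polytope P" and iso: "inclusion_iso \<psi> L (face_lattice P)"
    and XY: "X \<in> L" "Y \<in> L" "X \<subset> Y" "\<psi> X \<noteq> {}"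
    and cover: "\<And>Z. Z \<in> L \<Longrightarrow> X \<subseteq> Z \<Longrightarrow> Z \<subseteq> Y \<Longrightarrow> Z \<noteq> Y \<Longrightarrow> Z = X"
  shows "aff_dim (\<psi> Y) = aff_dim (\<psi> X) + 1"
proof -
  have bij: "bij_betw \<psi> L (face_lattice P)"
    and mono: "\<And>X Y. X \<in> L \<Longrightarrow> Y \<in> L \<Longrightarrow> \<psi> X \<subseteq> \<psi> Y \<longleftrightarrow> X \<subseteq> Y"
    using iso by (auto simp: inclusion_iso_def)
  have face: "\<psi> Z face_of P" if "Z \<in> L" for Z
    using bij_betw_apply[OF bij that] by (simp add: face_lattice_def)
  have poly: "polyhedron (\<psi> Y)"
    using face_of_polytope_polytope[OF P face[OF XY(2)]] by (rule polytope_imp_polyhedron)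
  have sub: "\<psi> X \<subseteq> \<psi> Y" "\<psi> X \<noteq> \<psi> Y"
    using mono[OF XY(1,2)] mono[OF XY(2,1)] XY(3) by auto
  have "\<psi> X face_of \<psi> Y"
    using face_of_subset[OF face[OF XY(1)] sub(1)] face_of_imp_subset[OF face[OF XY(2)]] by simp
  then obtain f where f: "f facet_of \<psi> Y" "\<psi> X \<subseteq> f"
    using face_of_polyhedron_subset_facet[OF poly] XY(4) sub(2) by metis
  then have "f face_of P"
    using face_of_trans[OF facet_of_imp_face_of face[OF XY(2)]] by blast
  then obtain Z where Z: "Z \<in> L" "\<psi> Z = f"
    using bij_betw_imp_surj_on[OF bij] by (metis (no_types, lifting) face_lattice_def imageE mem_Collect_eq)
  then have "Z = X"
  proof (intro cover[OF Z(1)])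
    show "X \<subseteq> Z" using f(2) mono[OF XY(1) Z(1)] Z(2) by simp
    show "Z \<subseteq> Y" using facet_of_imp_subset[OF f(1)] mono[OF Z(1) XY(2)] Z(2) by simp
    show "Z \<noteq> Y" using f(1) Z(2) by auto
  qed
  with Z f show ?thesis by (simp add: facet_of_def)
qed

text \<open>Every face of a polytope is exposed.\<close>

lemma face_supporting_functional:
  assumes P: "polytope P" and iso: "inclusion_iso \<psi> L (face_lattice P)" and X: "X \<in> L"
  obtains r h where "\<And>x. x \<in> P \<Longrightarrow> r \<bullet> x \<le> h" "\<And>x. x \<in> P \<Longrightarrow> r \<bullet> x = h \<longleftrightarrow> x \<in> \<psi> X"
proof -
  have "\<psi> X \<in> face_lattice P"
    using iso X by (auto simp: inclusion_iso_def bij_betw_def)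
  then have "\<psi> X exposed_face_of P"
    using exposed_face_of_polyhedron[OF polytope_imp_polyhedron[OF P]] by (simp add: face_lattice_def)
  then obtain r h where "P \<subseteq> {x. r \<bullet> x \<le> h}" "\<psi> X = P \<inter> {x. r \<bullet> x = h}"
    unfolding exposed_face_of_def by blast
  then show thesis by (intro that[of r h]) auto
qed

text \<open>Symmetries are compared only through their action on faces; evaluating at the face of a
  single vertex yields a statement about points.\<close>

lemma induced_on_points:
  fixes P :: "'a::euclidean_space set"
  assumes iso: "inclusion_iso \<psi> L (face_lattice P)"
    and L: "\<And>v. v \<in> \<Omega> \<Longrightarrow> {v} \<in> L"
    and p: "\<And>v. v \<in> \<Omega> \<Longrightarrow> \<psi> {v} = {p v}"
    and ind: "induces_via \<psi> L P H G"
    and S: "(\<lambda>F\<in>L. \<rho> ` F) \<in> G" and \<rho>: "\<And>v. v \<in> \<Omega> \<Longrightarrow> \<rho> v \<in> \<Omega>"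
  obtains f where "f \<in> H" "\<And>v. v \<in> \<Omega> \<Longrightarrow> f (p v) = p (\<rho> v)"
proof -
  have "transport \<psi> L P (\<lambda>F\<in>L. \<rho> ` F) \<in> induced_symmetry P ` H"
    using ind S unfolding induces_via_def by blast
  then obtain f where f: "f \<in> H" "induced_symmetry P f = transport \<psi> L P (\<lambda>F\<in>L. \<rho> ` F)"
    by (auto simp del: restrict_apply)
  have "f (p v) = p (\<rho> v)" if v: "v \<in> \<Omega>" for v
  proof -
    have bij: "bij_betw \<psi> L (face_lattice P)" using iso by (simp add: inclusion_iso_def)
    have "\<psi> {v} \<in> face_lattice P" using bij_betw_apply[OF bij L[OF v]] .
    moreover have "inv_into L \<psi> (\<psi> {v}) = {v}"
      using bij_betw_inv_into_left[OF bij L[OF v]] .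
    ultimately have "f ` \<psi> {v} = \<psi> {\<rho> v}"
      using fun_cong[OF f(2), of "\<psi> {v}"] L[OF v] by (simp add: induced_symmetry_def transport_def)
    then show ?thesis using p[OF v] p[OF \<rho>[OF v]] by simp
  qed
  with f(1) show thesis by (rule that)
qed

section \<open>The face lattice of \<open>E\<^sub>m\<^sub>n\<close>\<close>

text \<open>Row and column facets are bipyramids over copies of the two polygons, with two
  \<open>Prime\<close> or two \<open>DPrime\<close> apices; a cell facet is a bipyramid over a
  square with one apex of each kind.\<close>

definition row_facet :: "nat \<Rightarrow> nat \<Rightarrow> nat \<Rightarrow> emn_vertex set" where
  "row_facet m n i = {Vtx i j |j. j < n} \<union> {Prime ((i + (m - 1)) mod m), Prime i}"

definition col_facet :: "nat \<Rightarrow> nat \<Rightarrow> nat \<Rightarrow> emn_vertex set" where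
  "col_facet m n j = {Vtx i j |i. i < m} \<union> {DPrime ((j + (n - 1)) mod n), DPrime j}"

definition cell_facet :: "nat \<Rightarrow> nat \<Rightarrow> nat \<Rightarrow> nat \<Rightarrow> emn_vertex set" where
  "cell_facet m n i j = {Vtx i j, Vtx ((i + 1) mod m) j, Vtx i ((j + 1) mod n),
     Vtx ((i + 1) mod m) ((j + 1) mod n), Prime i, DPrime j}"

lemma emn_facets_cases:
  "F \<in> emn_facets m n \<longleftrightarrow>
    (\<exists>i<m. \<exists>j<n. F = cell_facet m n i j) \<or> (\<exists>i<m. F = row_facet m n i) \<or> (\<exists>j<n. F = col_facet m n j)"
  unfolding emn_facets_def cell_facet_def row_facet_def col_facet_def by blast

lemma row_facet_in: "i < m \<Longrightarrow> row_facet m n i \<in> emn_facets m n"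
  and col_facet_in: "j < n \<Longrightarrow> col_facet m n j \<in> emn_facets m n"
  and cell_facet_in: "i < m \<Longrightarrow> j < n \<Longrightarrow> cell_facet m n i j \<in> emn_facets m n"
  unfolding emn_facets_cases by blast+

lemma emn_facet_subset: "F \<in> emn_facets m n \<Longrightarrow> F \<subseteq> emn_vertices m n"
  unfolding emn_facets_cases cell_facet_def row_facet_def col_facet_def emn_vertices_def by auto

lemma emn_face_lattice_subset: "X \<in> emn_face_lattice m n \<Longrightarrow> X \<subseteq> emn_vertices m n"
  by (auto simp: emn_face_lattice_def)

lemma emn_facet_in_lattice: "F \<in> emn_facets m n \<Longrightarrow> F \<in> emn_face_lattice m n"
  using emn_facet_subset[of F m n] unfolding emn_face_lattice_def by (intro CollectI exI[of _ "{F}"]) auto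

lemma emn_vertices_in_lattice: "emn_vertices m n \<in> emn_face_lattice m n"
  unfolding emn_face_lattice_def by (intro CollectI exI[of _ "{}"]) auto

lemma emn_face_lattice_Int:
  assumes "X \<in> emn_face_lattice m n" "Y \<in> emn_face_lattice m n"
  shows "X \<inter> Y \<in> emn_face_lattice m n"
proof -
  obtain A B where "X = emn_vertices m n \<inter> \<Inter>A" "A \<subseteq> emn_facets m n"
    "Y = emn_vertices m n \<inter> \<Inter>B" "B \<subseteq> emn_facets m n"
    using assms unfolding emn_face_lattice_def by blast
  then show ?thesis
    unfolding emn_face_lattice_def by (intro CollectI exI[of _ "A \<union> B"]) auto
qed

lemma emn_proper_face_in_facet:
  assumes "X \<in> emn_face_lattice m n" "X \<noteq> emn_vertices m n"
  obtains F where "F \<in> emn_facets m n" "X \<subseteq> F"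
  using assms unfolding emn_face_lattice_def by blast

lemma mod_pred_eq_iff:
  fixes i k m :: nat
  assumes "i < m" "k < m"
  shows "(i + (m - 1)) mod m = k \<longleftrightarrow> i = (k + 1) mod m"
  using assms by (cases "i = 0"; cases "k + 1 = m") (auto simp: mod_if)

lemma Suc_mod_cyclic:
  fixes i m :: nat
  assumes "i < m" "m \<ge> 3"
  defines "k \<equiv> (i + 1) mod m"
  shows "k < m" "k \<noteq> i" "(k + (m - 1)) mod m = i" "(i + (m - 1)) mod m \<noteq> k"
proof -
  show k: "k < m" using assms by simp
  show "k \<noteq> i"
    using assms by (cases "i + 1 = m") (auto simp: k_def)
  show "(k + (m - 1)) mod m = i"
    by (subst mod_pred_eq_iff[OF k assms(1)]) (simp add: k_def)
  have "i \<noteq> (k + 1) mod m"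
    using assms by (cases "i + 1 = m"; cases "i + 2 = m") (auto simp: k_def)
  then show "(i + (m - 1)) mod m \<noteq> k"
    using mod_pred_eq_iff[OF assms(1) k] by simp
qed

text \<open>Each vertex is the meet of two facets: a row and a column facet for \<open>Vtx\<close>,
  two consecutive row or column facets for an apex. The latter share a single apex because the
  period is at least 3.\<close>

lemma emn_singleton_in_lattice:
  assumes mn: "m \<ge> 3" "n \<ge> 3" and v: "v \<in> emn_vertices m n"
  shows "{v} \<in> emn_face_lattice m n"
proof (cases v)
  case (Vtx i j)
  with v have ij: "i < m" "j < n" by (auto simp: emn_vertices_def)
  then have "{v} = row_facet m n i \<inter> col_facet m n j"
    by (auto simp: Vtx row_facet_def col_facet_def)
  moreover have "row_facet m n i \<in> emn_facets m n" "col_facet m n j \<in> emn_facets m n"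
    using ij by (simp_all add: row_facet_in col_facet_in)
  ultimately show ?thesis using emn_face_lattice_Int emn_facet_in_lattice by metis
next
  case (Prime i)
  with v have i: "i < m" by (auto simp: emn_vertices_def)
  have "{v} = row_facet m n i \<inter> row_facet m n ((i + 1) mod m)"
    using Suc_mod_cyclic[OF i mn(1)] by (auto simp: Prime row_facet_def)
  moreover have "row_facet m n i \<in> emn_facets m n" "row_facet m n ((i + 1) mod m) \<in> emn_facets m n"
    using i by (simp_all add: row_facet_in)
  ultimately show ?thesis using emn_face_lattice_Int emn_facet_in_lattice by metis
next
  case (DPrime j)
  with v have j: "j < n" by (auto simp: emn_vertices_def)
  have "{v} = col_facet m n j \<inter> col_facet m n ((j + 1) mod n)"
    using Suc_mod_cyclic[OF j mn(2)] by (auto simp: DPrime col_facet_def)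
  moreover have "col_facet m n j \<in> emn_facets m n" "col_facet m n ((j + 1) mod n) \<in> emn_facets m n"
    using j by (simp_all add: col_facet_in)
  ultimately show ?thesis using emn_face_lattice_Int emn_facet_in_lattice by metis
qed

lemma emn_empty_in_lattice:
  assumes mn: "m \<ge> 3" "n \<ge> 3"
  shows "{} \<in> emn_face_lattice m n"
proof -
  have "{Prime 0} \<in> emn_face_lattice m n" "{Prime 1} \<in> emn_face_lattice m n"
    using mn by (auto intro!: emn_singleton_in_lattice simp: emn_vertices_def)
  from emn_face_lattice_Int[OF this] show ?thesis by simp
qed

text \<open>Two \<open>Prime\<close> vertices exclude cell and column facets, and
  \<open>Vtx 0 0\<close> fixes the index of the row facet.\<close>

lemma row_facet_maximal:
  assumes mn: "m \<ge> 3" "n \<ge> 3" and X: "X \<in> emn_face_lattice m n" "row_facet m n 0 \<subseteq> X"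
    "X \<noteq> emn_vertices m n"
  shows "X = row_facet m n 0"
proof -
  obtain F where F: "F \<in> emn_facets m n" "X \<subseteq> F"
    using emn_proper_face_in_facet X by metis
  have sub: "{Vtx 0 0, Prime (m - 1), Prime 0} \<subseteq> F"
  proof -
    have "{Vtx 0 0, Prime (m - 1), Prime 0} \<subseteq> row_facet m n 0"
      using mn by (auto simp: row_facet_def)
    with X(2) F(2) show ?thesis by blast
  qed
  then have "F = row_facet m n 0"
    using F(1) unfolding emn_facets_cases
  proof (elim disjE exE conjE)
    fix i assume "i < m" "F = row_facet m n i"
    then show ?thesis using sub by (auto simp: row_facet_def)
  qed (use sub mn in \<open>auto simp: cell_facet_def col_facet_def\<close>)
  with X(2) F(2) show ?thesis by simp
qed

text \<open>The triangle is a ridge of the realisation: it lies in exactly two facets.\<close>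
lemma triangle_maximal:
  assumes mn: "m \<ge> 3" "n \<ge> 3"
  defines "T \<equiv> {Vtx 0 0, Vtx 0 1, Prime 0}"
  shows "T \<in> emn_face_lattice m n" "T \<subset> row_facet m n 0"
    "\<And>X. X \<in> emn_face_lattice m n \<Longrightarrow> T \<subseteq> X \<Longrightarrow> X \<subseteq> row_facet m n 0 \<Longrightarrow> X \<noteq> row_facet m n 0 \<Longrightarrow> X = T"
proof -
  have T: "T = cell_facet m n 0 0 \<inter> row_facet m n 0"
    using mn by (auto simp: T_def cell_facet_def row_facet_def)
  have "cell_facet m n 0 0 \<in> emn_facets m n" and row: "row_facet m n 0 \<in> emn_facets m n"
    using mn by (simp_all add: row_facet_in cell_facet_in)
  then show "T \<in> emn_face_lattice m n"
    unfolding T using emn_face_lattice_Int emn_facet_in_lattice by metis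
  have "Prime (m - 1) \<in> row_facet m n 0" "Prime (m - 1) \<notin> T"
    using mn by (auto simp: T_def row_facet_def)
  then show strict: "T \<subset> row_facet m n 0" using T by blast
  have facet: "F = cell_facet m n 0 0 \<or> F = row_facet m n 0" if F: "F \<in> emn_facets m n" "T \<subseteq> F" for F
    using F(1) unfolding emn_facets_cases
  proof (elim disjE exE conjE)
    fix i j assume ij: "i < m" "j < n" "F = cell_facet m n i j"
    with F(2) have "i = 0" "Vtx 0 0 \<in> cell_facet m n i j" "Vtx 0 1 \<in> cell_facet m n i j"
      by (auto simp: T_def cell_facet_def)
    \<comment> \<open>The alternative \<open>j = n - 1\<close> gives the second indices
      \<open>n - 1\<close> and 0, which miss 1 because \<open>n \<ge> 3\<close>.\<close>
    then have "j = 0"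
      using ij(2) mn by (cases "j + 1 = n") (auto simp: cell_facet_def)
    with ij \<open>i = 0\<close> show ?thesis by simp
  next
    fix i assume "i < m" "F = row_facet m n i"
    with F(2) show ?thesis by (auto simp: T_def row_facet_def)
  next
    fix j assume "j < n" "F = col_facet m n j"
    with F(2) show ?thesis by (auto simp: T_def col_facet_def)
  qed
  fix X assume X: "X \<in> emn_face_lattice m n" "T \<subseteq> X" "X \<subseteq> row_facet m n 0" "X \<noteq> row_facet m n 0"
  then obtain A where A: "A \<subseteq> emn_facets m n" "X = emn_vertices m n \<inter> \<Inter>A"
    unfolding emn_face_lattice_def by blast
  then have "A \<subseteq> {cell_facet m n 0 0, row_facet m n 0}"
    using facet X(2) by blast
  \<comment> \<open>Without the cell facet in the family, \<open>X\<close> would contain the whole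
    row facet.\<close>
  moreover have "\<not> A \<subseteq> {row_facet m n 0}"
  proof
    assume "A \<subseteq> {row_facet m n 0}"
    then have "row_facet m n 0 \<subseteq> X"
      using A(2) emn_facet_subset[OF row] by auto
    with X(3,4) show False by simp
  qed
  ultimately have "X \<subseteq> cell_facet m n 0 0" using A(2) by auto
  with X(2,3) show "X = T" unfolding T by blast
qed

section \<open>The rotation group\<close>

text \<open>One family for all products of the two rotations; its natural exponents simply add under
  composition.\<close>

fun rot :: "nat \<Rightarrow> nat \<Rightarrow> nat \<Rightarrow> nat \<Rightarrow> emn_vertex \<Rightarrow> emn_vertex" where
  "rot m n a b (Vtx i j) = Vtx ((i + a) mod m) ((j + b) mod n)"
| "rot m n a b (Prime i) = Prime ((i + a) mod m)"
| "rot m n a b (DPrime j) = DPrime ((j + b) mod n)"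

definition rot_face :: "nat \<Rightarrow> nat \<Rightarrow> nat \<Rightarrow> nat \<Rightarrow> emn_vertex set \<Rightarrow> emn_vertex set" where
  "rot_face m n a b = (\<lambda>X\<in>emn_face_lattice m n. rot m n a b ` X)"

lemma rot_rot: "rot m n a b (rot m n a' b' v) = rot m n (a + a') (b + b') v"
  by (cases v) (simp_all add: mod_simps add_ac)

lemma rot_mod: "rot m n (a mod m) (b mod n) = rot m n a b"
proof
  show "rot m n (a mod m) (b mod n) v = rot m n a b v" for v
    by (cases v) (simp_all add: mod_simps)
qed

lemma rot_id:
  assumes "v \<in> emn_vertices m n"
  shows "rot m n (m * a) (n * b) v = v"
  using assms by (auto simp: emn_vertices_def)

lemma rot_in:
  assumes "m > 0" "n > 0" "v \<in> emn_vertices m n"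
  shows "rot m n a b v \<in> emn_vertices m n"
  using assms by (auto simp: emn_vertices_def)

text \<open>\<open>rot\<close> reduces the unmoved index modulo its period while the generators
  leave it alone, so the comparison is made on genuine vertices.\<close>

lemma rot_fst_eq: "v \<in> emn_vertices m n \<Longrightarrow> rot_fst m v = rot m n 1 0 v"
  and rot_snd_eq: "v \<in> emn_vertices m n \<Longrightarrow> rot_snd n v = rot m n 0 1 v"
  by (auto simp: emn_vertices_def)

text \<open>With natural exponents \<open>(m - 1) * a\<close> stands for minus \<open>a\<close>,
  since the total \<open>m * a\<close> acts trivially.\<close>

lemma rot_inverse:
  assumes mn: "m > 0" "n > 0" and v: "v \<in> emn_vertices m n"
  shows "rot m n ((m - 1) * a) ((n - 1) * b) (rot m n a b v) = v"
    "rot m n a b (rot m n ((m - 1) * a) ((n - 1) * b) v) = v"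
proof -
  have "(m - 1) * a + a = m * a" "(n - 1) * b + b = n * b"
    using mn by (metis Suc_pred' add.commute diff_Suc_1 mult_Suc)+
  then show "rot m n ((m - 1) * a) ((n - 1) * b) (rot m n a b v) = v"
    "rot m n a b (rot m n ((m - 1) * a) ((n - 1) * b) v) = v"
    unfolding rot_rot using rot_id[OF v] by (simp_all add: add.commute)
qed

lemma cyclic_shift_image: "(\<lambda>j. (j + b) mod n) ` {j. j < n} = {j. j < n}" if "n > 0" for n b :: nat
proof
  show "{j. j < n} \<subseteq> (\<lambda>j. (j + b) mod n) ` {j. j < n}"
  proof
    fix j assume "j \<in> {j. j < n}"
    moreover have "j + (n - 1) * b + b = j + n * b" using that by (cases n) simp_all
    ultimately have "j = ((j + (n - 1) * b) mod n + b) mod n" by (simp only: mod_add_left_eq) simp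
    then show "j \<in> (\<lambda>j. (j + b) mod n) ` {j. j < n}"
      by (rule image_eqI) (use that in simp)
  qed
qed (use that in auto)

lemma rot_facet:
  assumes mn: "m > 0" "n > 0" and F: "F \<in> emn_facets m n"
  shows "rot m n a b ` F \<in> emn_facets m n"
  using F unfolding emn_facets_cases[of F]
proof (elim disjE exE conjE)
  fix i j assume ij: "i < m" "j < n" "F = cell_facet m n i j"
  have "rot m n a b ` F = cell_facet m n ((i + a) mod m) ((j + b) mod n)"
    unfolding ij by (simp add: cell_facet_def mod_simps)
  then show ?thesis using mn by (simp add: cell_facet_in)
next
  fix i assume i: "i < m" "F = row_facet m n i"
  have "rot m n a b ` F = Vtx ((i + a) mod m) ` ((\<lambda>j. (j + b) mod n) ` {j. j < n})
      \<union> {Prime ((i + (m - 1) + a) mod m), Prime ((i + a) mod m)}"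
    by (simp add: i row_facet_def setcompr_eq_image image_Un image_image mod_simps)
  also have "\<dots> = row_facet m n ((i + a) mod m)"
    unfolding cyclic_shift_image[OF mn(2)] row_facet_def setcompr_eq_image
    by (simp add: mod_simps add_ac)
  finally have "rot m n a b ` F = row_facet m n ((i + a) mod m)" .
  then show ?thesis using mn by (simp add: row_facet_in)
next
  fix j assume j: "j < n" "F = col_facet m n j"
  have "rot m n a b ` F = (\<lambda>i. Vtx i ((j + b) mod n)) ` ((\<lambda>i. (i + a) mod m) ` {i. i < m})
      \<union> {DPrime ((j + (n - 1) + b) mod n), DPrime ((j + b) mod n)}"
    by (simp add: j col_facet_def setcompr_eq_image image_Un image_image mod_simps)
  also have "\<dots> = col_facet m n ((j + b) mod n)"
    unfolding cyclic_shift_image[OF mn(1)] col_facet_def setcompr_eq_image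
    by (simp add: mod_simps add_ac)
  finally have "rot m n a b ` F = col_facet m n ((j + b) mod n)" .
  then show ?thesis using mn by (simp add: col_facet_in)
qed

text \<open>Rotating a family of facets that cuts out \<open>X\<close> gives one that cuts out the
  image; the inverse rotation shows that its meet contains nothing more.\<close>

lemma rot_face_in:
  assumes mn: "m > 0" "n > 0" and X: "X \<in> emn_face_lattice m n"
  shows "rot m n a b ` X \<in> emn_face_lattice m n"
proof -
  obtain A where A: "A \<subseteq> emn_facets m n" "X = emn_vertices m n \<inter> \<Inter>A"
    using X unfolding emn_face_lattice_def by blast
  let ?r = "rot m n a b" and ?s = "rot m n ((m - 1) * a) ((n - 1) * b)"
  have "?r ` X = emn_vertices m n \<inter> \<Inter>((`) ?r ` A)"
  proof
    show "?r ` X \<subseteq> emn_vertices m n \<inter> \<Inter>((`) ?r ` A)"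
      using A rot_in[OF mn] by auto
    show "emn_vertices m n \<inter> \<Inter>((`) ?r ` A) \<subseteq> ?r ` X"
    proof
      fix v assume v: "v \<in> emn_vertices m n \<inter> \<Inter>((`) ?r ` A)"
      have "?s v \<in> F" if F: "F \<in> A" for F
      proof -
        obtain w where "w \<in> F" "v = ?r w" using v F by blast
        moreover have "w \<in> emn_vertices m n"
          using emn_facet_subset A(1) F \<open>w \<in> F\<close> by blast
        ultimately show ?thesis using rot_inverse(1)[OF mn] by simp
      qed
      then have "?s v \<in> X" using A(2) v rot_in[OF mn] by auto
      then show "v \<in> ?r ` X" using rot_inverse(2)[OF mn, of v] v by (metis IntD1 imageI)
    qed
  qed
  moreover have "(`) ?r ` A \<subseteq> emn_facets m n"
    using A(1) rot_facet[OF mn] by blast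
  ultimately show ?thesis unfolding emn_face_lattice_def by blast
qed

lemma rot_face_compose:
  assumes "m > 0" "n > 0"
  shows "compose (emn_face_lattice m n) (rot_face m n a b) (rot_face m n a' b') = rot_face m n (a + a') (b + b')"
  using rot_face_in[OF assms] by (auto simp: compose_def rot_face_def fun_eq_iff image_image rot_rot)

lemma rot_face_0: "rot_face m n 0 0 = (\<lambda>X\<in>emn_face_lattice m n. X)"
proof -
  have "rot m n 0 0 ` X = X" if "X \<in> emn_face_lattice m n" for X
    using rot_id[of _ m n 0 0] emn_face_lattice_subset[OF that] by (force simp: image_iff)
  then show ?thesis unfolding rot_face_def by (rule restrict_ext)
qed

lemma rot_face_comb_symmetry:
  assumes mn: "m > 0" "n > 0"
  shows "rot_face m n a b \<in> carrier (comb_symmetry_group (emn_face_lattice m n))"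
proof -
  let ?L = "emn_face_lattice m n" and ?r = "rot m n a b" and ?s = "rot m n ((m - 1) * a) ((n - 1) * b)"
  have inv: "?s ` ?r ` X = X" "?r ` ?s ` X = X" if X: "X \<in> ?L" for X
  proof -
    have "v \<in> emn_vertices m n" if "v \<in> X" for v
      using emn_face_lattice_subset[OF X] that by blast
    then have "(\<lambda>v. ?s (?r v)) ` X = (\<lambda>v. v) ` X" "(\<lambda>v. ?r (?s v)) ` X = (\<lambda>v. v) ` X"
      using rot_inverse[OF mn] by (metis (no_types, lifting) image_cong)+
    then show "?s ` ?r ` X = X" "?r ` ?s ` X = X" unfolding image_image by simp_all
  qed
  have "bij_betw ((`) ?r) ?L ?L"
  proof (rule bij_betw_byWitness[where f' = "(`) ?s"])
    show "\<forall>X\<in>?L. ?s ` ?r ` X = X" "\<forall>X\<in>?L. ?r ` ?s ` X = X" using inv by simp_all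
    show "(`) ?r ` ?L \<subseteq> ?L" "(`) ?s ` ?L \<subseteq> ?L" using rot_face_in[OF mn] by blast+
  qed
  then have bij: "bij_betw (rot_face m n a b) ?L ?L"
    by (simp add: rot_face_def cong: bij_betw_cong)
  moreover have "X \<subseteq> Y \<longleftrightarrow> ?r ` X \<subseteq> ?r ` Y" if "X \<in> ?L" "Y \<in> ?L" for X Y
    using inv(1)[OF that(1)] inv(1)[OF that(2)] by (metis image_mono)
  ultimately show ?thesis
    by (simp add: comb_symmetry_group_def inclusion_iso_def Bij_def rot_face_def)
qed

lemma S_fst_eq: "S_fst m n = rot_face m n 1 0" and S_snd_eq: "S_snd m n = rot_face m n 0 1"
proof -
  have eq: "rot_fst m ` X = rot m n 1 0 ` X \<and> rot_snd n ` X = rot m n 0 1 ` X"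
    if X: "X \<in> emn_face_lattice m n" for X
  proof -
    have "v \<in> emn_vertices m n" if "v \<in> X" for v
      using emn_face_lattice_subset[OF X] that by blast
    then show ?thesis using rot_fst_eq rot_snd_eq by (metis (no_types, lifting) image_cong)
  qed
  show "S_fst m n = rot_face m n 1 0" "S_snd m n = rot_face m n 0 1"
    unfolding S_fst_def S_snd_def rot_face_def by (rule restrict_ext, simp only: eq)+
qed

text \<open>The image of a homomorphism is a subgroup and contains both generators; conversely every
  \<open>rot_face\<close> is a product of generators. Residues are integers read as naturals, and
  \<open>face_mod\<close> absorbs their reduction.\<close>

lemma rotation_subgroup_parametrization:
  assumes mn: "m > 0" "n > 0"
  defines "G \<equiv> comb_symmetry_group (emn_face_lattice m n)"
    and "K \<equiv> integer_mod_group m \<times>\<times> integer_mod_group n"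
    and "h \<equiv> \<lambda>(x, y). rot_face m n (nat x) (nat y)"
  shows "h \<in> hom K G" "h ` carrier K = rotation_subgroup m n"
proof -
  let ?L = "emn_face_lattice m n"
  interpret G: group G unfolding G_def by (rule group_comb_symmetry_group)
  have K: "group K" unfolding K_def by (intro DirProd_group group_integer_mod_group)
  have carrier_K: "carrier K = {0..<int m} \<times> {0..<int n}"
    using mn by (simp add: K_def carrier_integer_mod_group)
  have in_G: "rot_face m n a b \<in> carrier G" for a b
    unfolding G_def by (rule rot_face_comb_symmetry[OF mn])
  have mult: "rot_face m n a b \<otimes>\<^bsub>G\<^esub> rot_face m n a' b' = rot_face m n (a + a') (b + b')" for a b a' b'
    using in_G rot_face_compose[OF mn]
    by (simp add: G_def comb_symmetry_group_def BijGroup_def)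
  have one: "\<one>\<^bsub>G\<^esub> = rot_face m n 0 0"
    by (simp add: rot_face_0 G_def comb_symmetry_group_def BijGroup_def)
  have face_mod: "rot_face m n (a mod m) (b mod n) = rot_face m n a b" for a b
    by (simp add: rot_face_def rot_mod)
  have nat_mod: "nat ((x + x') mod int k) = (nat x + nat x') mod k" if "0 \<le> x" "0 \<le> x'" for x x' k
    using that by (simp add: nat_mod_distrib nat_add_distrib)
  show hom: "h \<in> hom K G"
  proof (rule homI)
    show "h x \<in> carrier G" if "x \<in> carrier K" for x
      using in_G by (simp add: h_def split: prod.split)
    show "h (x \<otimes>\<^bsub>K\<^esub> y) = h x \<otimes>\<^bsub>G\<^esub> h y" if "x \<in> carrier K" "y \<in> carrier K" for x y
      using that unfolding carrier_K
      by (auto simp: K_def h_def mult nat_mod face_mod)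
  qed
  then interpret h: group_hom K G h
    using K by (simp add: group_hom_def group_hom_axioms_def G.is_group)
  have img: "rot_face m n a b \<in> h ` carrier K" for a b
  proof
    show "rot_face m n a b = h (int (a mod m), int (b mod n))"
      by (simp add: h_def face_mod)
    show "(int (a mod m), int (b mod n)) \<in> carrier K"
      using mn by (simp add: carrier_K)
  qed
  define R where "R = generate G {S_fst m n, S_snd m n}"
  have gen: "rot_face m n a b \<in> R" for a b
  proof -
    have gens: "rot_face m n 1 0 \<in> R" "rot_face m n 0 1 \<in> R"
      unfolding R_def S_fst_eq S_snd_eq by (auto intro: generate.incl)
    have step: "x \<otimes>\<^bsub>G\<^esub> y \<in> R" if "x \<in> R" "y \<in> R" for x y
      using that unfolding R_def by (rule generate.eng)
    have "rot_face m n 0 b \<in> R" for b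
    proof (induction b)
      case 0 show ?case unfolding R_def one[symmetric] by (rule generate.one)
    next
      case (Suc b) from step[OF gens(2) this] show ?case by (simp add: mult)
    qed
    then show ?thesis
    proof (induction a)
      case (Suc a) from step[OF gens(1) Suc.IH[OF Suc.prems]] show ?case by (simp add: mult)
    qed simp
  qed
  have "R \<subseteq> h ` carrier K"
    unfolding R_def
    by (rule G.generate_subgroup_incl[OF _ h.img_is_subgroup]) (use img in \<open>simp add: S_fst_eq S_snd_eq\<close>)
  moreover have "h ` carrier K \<subseteq> R"
    using gen by (auto simp: h_def)
  ultimately show "h ` carrier K = rotation_subgroup m n"
    by (simp add: R_def rotation_subgroup_def G_def)
qed

lemma rotation_subgroup_structure:
  assumes mn: "m \<ge> 3" "n \<ge> 3"
  defines "G \<equiv> comb_symmetry_group (emn_face_lattice m n)"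
  shows "subgroup (rotation_subgroup m n) G"
    and "G\<lparr>carrier := rotation_subgroup m n\<rparr> \<cong> integer_mod_group m \<times>\<times> integer_mod_group n"
proof -
  define K where "K = integer_mod_group m \<times>\<times> integer_mod_group n"
  define h where "h = (\<lambda>(x, y). rot_face m n (nat x) (nat y))"
  have pos: "m > 0" "n > 0" using mn by auto
  have hom: "h \<in> hom K G" and img: "h ` carrier K = rotation_subgroup m n"
    using rotation_subgroup_parametrization[OF pos] by (simp_all add: K_def h_def G_def)
  have K: "group K" unfolding K_def by (intro DirProd_group group_integer_mod_group)
  interpret h: group_hom K G h
    using K hom group_comb_symmetry_group by (simp add: group_hom_def group_hom_axioms_def G_def)
  show "subgroup (rotation_subgroup m n) G" using h.img_is_subgroup img by simp
  \<comment> \<open>The images of the faces \<open>{Prime 0}\<close> and \<open>{DPrime 0}\<close>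
    reveal the two exponents.\<close>
  have "inj_on h (carrier K)"
  proof (rule inj_onI, clarify)
    fix x y x' y' assume xy: "(x, y) \<in> carrier K" "(x', y') \<in> carrier K" "h (x, y) = h (x', y')"
    then have bounds: "0 \<le> x" "x < m" "0 \<le> y" "y < n" "0 \<le> x'" "x' < m" "0 \<le> y'" "y' < n"
      using pos by (simp_all add: K_def carrier_integer_mod_group)
    have "{Prime 0} \<in> emn_face_lattice m n" "{DPrime 0} \<in> emn_face_lattice m n"
      using mn by (auto intro!: emn_singleton_in_lattice simp: emn_vertices_def)
    then have "nat x mod m = nat x' mod m" "nat y mod n = nat y' mod n"
      using fun_cong[OF xy(3), of "{Prime 0}"] fun_cong[OF xy(3), of "{DPrime 0}"]
      by (simp_all add: h_def rot_face_def)
    then show "x = x' \<and> y = y'" using bounds by (simp add: nat_less_iff eq_nat_nat_iff)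
  qed
  then have "h \<in> Group.iso K (G\<lparr>carrier := rotation_subgroup m n\<rparr>)"
    using hom img by (intro isoI) (auto simp: hom_def bij_betw_def)
  then show "G\<lparr>carrier := rotation_subgroup m n\<rparr> \<cong> integer_mod_group m \<times>\<times> integer_mod_group n"
    unfolding K_def[symmetric] by (rule group.iso_sym[OF K is_isoI])
qed

section \<open>Symmetric realisations\<close>

lemma affine_symmetry_linear_part:
  assumes "f \<in> carrier (geom_symmetry_group P)"
  obtains g where "linear g" "\<And>x y. g (x - y) = f x - f y"
proof -
  from assms obtain c g where "linear g" "f = (\<lambda>x. c + g x)"
    by (auto simp: geom_symmetry_group_def affine_transformation_def)
  then show thesis by (intro that[of g]) (simp_all add: linear_diff)
qed

text \<open>\<open>f\<close> permutes the family of points, so it fixes their barycentre, and about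
  a fixed point an affine map acts by its linear part.\<close>

lemma linear_part_at_barycenter:
  fixes p :: "'b \<Rightarrow> 'a::euclidean_space"
  assumes g: "linear g" "\<And>x y. g (x - y) = f x - f y"
    and fin: "finite \<Omega>" "\<Omega> \<noteq> {}" and \<rho>: "bij_betw \<rho> \<Omega> \<Omega>"
    and f: "\<And>v. v \<in> \<Omega> \<Longrightarrow> f (p v) = p (\<rho> v)"
  defines "c \<equiv> (1 / card \<Omega>) *\<^sub>R (\<Sum>v\<in>\<Omega>. p v)"
  assumes v: "v \<in> \<Omega>"
  shows "g (p v - c) = p (\<rho> v) - c"
proof -
  have "(\<Sum>w\<in>\<Omega>. p w - c) = 0"
    using fin by (simp add: sum_subtractf c_def sum_constant_scaleR)
  then have "(\<Sum>w\<in>\<Omega>. g (p w - c)) = 0"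
    by (metis g(1) linear_0 linear_sum)
  then have "(\<Sum>w\<in>\<Omega>. p (\<rho> w)) = card \<Omega> *\<^sub>R f c"
    using fin by (simp add: g(2) f sum_subtractf sum_constant_scaleR)
  also have "(\<Sum>w\<in>\<Omega>. p (\<rho> w)) = (\<Sum>w\<in>\<Omega>. p w)"
    by (rule sum.reindex_bij_betw[OF \<rho>])
  finally have eq: "real (card \<Omega>) *\<^sub>R f c = (\<Sum>w\<in>\<Omega>. p w)" by (rule sym)
  have "f c = (1 / card \<Omega>) *\<^sub>R (real (card \<Omega>) *\<^sub>R f c)" using fin by simp
  also have "\<dots> = c" unfolding eq by (simp only: c_def)
  finally have "f c = c" .
  then show ?thesis using g(2) f[OF v] by simp
qed

lemma finite_emn_vertices: "finite (emn_vertices m n)"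
proof -
  have "emn_vertices m n = (\<lambda>(i, j). Vtx i j) ` ({..<m} \<times> {..<n}) \<union> Prime ` {..<m} \<union> DPrime ` {..<n}"
    by (auto simp: emn_vertices_def image_iff)
  then show ?thesis by simp
qed

lemma rot_bij:
  assumes mn: "m > 0" "n > 0"
  shows "bij_betw (rot m n a b) (emn_vertices m n) (emn_vertices m n)"
  by (rule bij_betw_byWitness[where f' = "rot m n ((m - 1) * a) ((n - 1) * b)"])
    (use rot_inverse[OF mn] rot_in[OF mn] in blast)+

text \<open>The barycentre lies in the convex hull, so after translation 0 lies in the affine hull,
  and affine and linear dimension agree.\<close>

lemma dim_translated_le:
  fixes p :: "'b \<Rightarrow> 'a::euclidean_space"
  assumes fin: "finite \<Omega>" "\<Omega> \<noteq> {}"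
  defines "c \<equiv> (1 / card \<Omega>) *\<^sub>R (\<Sum>v\<in>\<Omega>. p v)"
  shows "int (dim (span ((\<lambda>v. p v - c) ` \<Omega>))) = aff_dim (p ` \<Omega>)"
proof -
  have "(\<Sum>v\<in>\<Omega>. (1 / card \<Omega>) *\<^sub>R (p v - c)) \<in> convex hull ((\<lambda>v. p v - c) ` \<Omega>)"
    by (rule convex_sum) (use fin in \<open>auto intro: hull_inc\<close>)
  also have "(\<Sum>v\<in>\<Omega>. (1 / card \<Omega>) *\<^sub>R (p v - c)) = 0"
    using fin by (simp add: c_def scaleR_sum_right[symmetric] sum_subtractf sum_constant_scaleR)
  finally have "0 \<in> affine hull ((\<lambda>v. p v - c) ` \<Omega>)"
    using convex_hull_subset_affine_hull by blast
  then have "aff_dim ((\<lambda>x. x - c) ` p ` \<Omega>) = int (dim ((\<lambda>v. p v - c) ` \<Omega>))"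
    by (simp add: aff_dim_zero image_image)
  then show ?thesis by (simp add: aff_dim_translation_eq_subtract)
qed

text \<open>Triangle, bipyramid and polytope are consecutive faces, so the dimension is at most \<open>2 + 1 + 1\<close>.\<close>
lemma emn_realization_aff_dim_le:
  fixes P :: "'a::euclidean_space set"
  assumes mn: "m \<ge> 3" "n \<ge> 3" and P: "polytope P"
    and iso: "inclusion_iso \<psi> (emn_face_lattice m n) (face_lattice P)"
    and hull: "\<And>X. X \<in> emn_face_lattice m n \<Longrightarrow> \<psi> X = convex hull (p ` X)"
  shows "aff_dim (p ` emn_vertices m n) \<le> 4"
proof -
  define T where "T = {Vtx 0 0, Vtx 0 1, Prime 0}"
  let ?L = "emn_face_lattice m n" and ?R = "row_facet m n 0" and ?\<Omega> = "emn_vertices m n"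
  note T = triangle_maximal[OF mn, folded T_def]
  have R: "?R \<in> ?L" using mn by (simp add: emn_facet_in_lattice row_facet_in)
  have "Prime 1 \<in> ?\<Omega>" "Prime 1 \<notin> ?R"
    using mn by (auto simp: emn_vertices_def row_facet_def)
  then have "?R \<subset> ?\<Omega>" using emn_face_lattice_subset[OF R] by blast
  then have "aff_dim (\<psi> ?\<Omega>) = aff_dim (\<psi> ?R) + 1"
    using row_facet_maximal[OF mn] hull[OF R] mn
    by (intro aff_dim_cover[OF P iso R emn_vertices_in_lattice]) (auto simp: row_facet_def)
  also have "aff_dim (\<psi> ?R) = aff_dim (\<psi> T) + 1"
  proof (rule aff_dim_cover[OF P iso T(1) R T(2)])
    show "\<psi> T \<noteq> {}" unfolding hull[OF T(1)] by (simp add: T_def)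
  qed (rule T(3))
  also have "aff_dim (\<psi> T) = aff_dim (p ` T)"
    by (simp add: hull[OF T(1)] aff_dim_convex_hull)
  also have "\<dots> \<le> int (card (p ` T)) - 1" by (rule aff_dim_le_card) (simp add: T_def)
  also have "int (card (p ` T)) \<le> 3"
    using card_image_le[of T p] by (simp add: T_def card_insert_if split: if_splits)
  finally show ?thesis by (simp add: hull[OF emn_vertices_in_lattice] aff_dim_convex_hull)
qed

text \<open>The differences of \<open>k\<close> from \<open>i\<close> and from \<open>i + 1\<close>
  lie strictly between 0 and \<open>m\<close>.\<close>

lemma mod_window:
  fixes i k m :: nat
  assumes "i + 2 \<le> k" "k < i + m"
  shows "k mod m \<noteq> i mod m" "k mod m \<noteq> Suc i mod m"
proof -
  have "\<not> m dvd k - i" "\<not> m dvd k - Suc i"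
    using assms by (auto dest!: dvd_imp_le)
  then show "k mod m \<noteq> i mod m" "k mod m \<noteq> Suc i mod m"
    using assms mod_eq_dvd_iff_nat[of i k m] mod_eq_dvd_iff_nat[of "Suc i" k m] by auto
qed

text \<open>Passes from faces to vectors: vertices are centred at their barycentre, symmetries
  become linear maps and facets become supporting functionals, as \<open>two_rotations_bound\<close>
  requires.\<close>

lemma symmetric_realization_bound:
  fixes P :: "'a::euclidean_space set"
  assumes mn: "m \<ge> 3" "n \<ge> 3" and P: "polytope P"
    and iso: "inclusion_iso \<psi> (emn_face_lattice m n) (face_lattice P)"
    and H: "subgroup H (geom_symmetry_group P)"
    and ind: "induces_via \<psi> (emn_face_lattice m n) P H (rotation_subgroup m n)"
  shows "m * n \<le> 2 * (m + n)"
proof -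
  let ?L = "emn_face_lattice m n" and ?\<Omega> = "emn_vertices m n"
  have pos: "m > 0" "n > 0" using mn by auto
  note sing = emn_singleton_in_lattice[OF mn]
  obtain p where p: "\<And>v. v \<in> ?\<Omega> \<Longrightarrow> \<psi> {v} = {p v}"
    and hull: "\<And>X. X \<in> ?L \<Longrightarrow> \<psi> X = convex hull (p ` X)"
    and p_in: "\<And>X v. X \<in> ?L \<Longrightarrow> v \<in> ?\<Omega> \<Longrightarrow> p v \<in> \<psi> X \<longleftrightarrow> v \<in> X"
    using realization_points[OF P iso emn_empty_in_lattice[OF mn] sing emn_face_lattice_subset] by metis
  define c where "c = (1 / card ?\<Omega>) *\<^sub>R (\<Sum>v\<in>?\<Omega>. p v)"
  define q where "q v = p v - c" for v
  have fin: "finite ?\<Omega>" by (rule finite_emn_vertices)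
  have "Prime 0 \<in> ?\<Omega>" using mn by (simp add: emn_vertices_def)
  then have ne: "?\<Omega> \<noteq> {}" by blast
  have pP: "p v \<in> P" if "v \<in> ?\<Omega>" for v
  proof -
    have "\<psi> {v} face_of P"
      using iso sing[OF that] by (auto simp: inclusion_iso_def face_lattice_def bij_betw_def)
    then show ?thesis using p[OF that] face_of_imp_subset by blast
  qed
  have functional: "\<exists>r h. (\<forall>v\<in>?\<Omega>. r \<bullet> q v \<le> h) \<and> (\<forall>v\<in>?\<Omega>. r \<bullet> q v = h \<longleftrightarrow> v \<in> F)"
    if F: "F \<in> emn_facets m n" for F
  proof -
    have FL: "F \<in> ?L" by (rule emn_facet_in_lattice[OF F])
    obtain r h where rh: "\<And>x. x \<in> P \<Longrightarrow> r \<bullet> x \<le> h" "\<And>x. x \<in> P \<Longrightarrow> r \<bullet> x = h \<longleftrightarrow> x \<in> \<psi> F"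
      using face_supporting_functional[OF P iso FL] by metis
    show ?thesis
      by (intro exI[of _ r] exI[of _ "h - r \<bullet> c"])
        (use rh pP p_in[OF FL] in \<open>auto simp: q_def inner_diff_right\<close>)
  qed
  have linear_rot: "\<exists>g. linear g \<and> (\<forall>v\<in>?\<Omega>. g (q v) = q (rot m n a b v))"
    if ab: "rot_face m n a b \<in> rotation_subgroup m n" for a b
  proof -
    obtain f where f: "f \<in> H" "\<And>v. v \<in> ?\<Omega> \<Longrightarrow> f (p v) = p (rot m n a b v)"
      using induced_on_points[OF iso sing p ind ab[unfolded rot_face_def] rot_in[OF pos]] by metis
    have "f \<in> carrier (geom_symmetry_group P)" by (rule subgroup.mem_carrier[OF H f(1)])
    then obtain g where g: "linear g" "\<And>x y. g (x - y) = f x - f y"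
      by (rule affine_symmetry_linear_part) (rule that, assumption, simp)
    have "g (q w) = q (rot m n a b w)" if "w \<in> ?\<Omega>" for w
      unfolding q_def c_def
      by (rule linear_part_at_barycenter[of g f ?\<Omega> "rot m n a b" p w,
            OF g fin ne rot_bij[OF pos] f(2) that])
    with g(1) show ?thesis by blast
  qed
  have "rot_face m n 1 0 \<in> rotation_subgroup m n" "rot_face m n 0 1 \<in> rotation_subgroup m n"
    unfolding S_fst_eq[symmetric] S_snd_eq[symmetric] rotation_subgroup_def
    by (auto intro: generate.incl)
  then obtain \<alpha> \<beta> where lin: "linear \<alpha>" "linear \<beta>"
    and \<alpha>: "\<And>v. v \<in> ?\<Omega> \<Longrightarrow> \<alpha> (q v) = q (rot m n 1 0 v)"
    and \<beta>: "\<And>v. v \<in> ?\<Omega> \<Longrightarrow> \<beta> (q v) = q (rot m n 0 1 v)"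
    using linear_rot by metis
  \<comment> \<open>Reduction modulo the periods extends the vertex families to all natural
    indices.\<close>
  define a where "a i = q (Prime (i mod m))" for i
  define b where "b j = q (DPrime (j mod n))" for j
  define v where "v i j = q (Vtx (i mod m) (j mod n))" for i j
  have mem: "Prime (i mod m) \<in> ?\<Omega>" "DPrime (j mod n) \<in> ?\<Omega>" "Vtx (i mod m) (j mod n) \<in> ?\<Omega>" for i j
    using pos by (simp_all add: emn_vertices_def)
  have "int (dim (span (q ` ?\<Omega>))) = aff_dim (p ` ?\<Omega>)"
    unfolding q_def c_def by (rule dim_translated_le[OF fin ne])
  also have "\<dots> \<le> 4" by (rule emn_realization_aff_dim_le[OF mn P iso hull])
  finally have dim: "dim (span (q ` ?\<Omega>)) \<le> 4" by simp
  have mod_pred: "(Suc i mod k + (k - 1)) mod k = i mod k" if "k > 0" for i k :: nat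
  proof -
    have "(Suc i mod k + (k - 1)) mod k = (Suc i + (k - 1)) mod k" by (rule mod_add_left_eq)
    also have "Suc i + (k - 1) = i + k" using that by simp
    finally show ?thesis by simp
  qed
  show ?thesis
  proof (rule two_rotations_bound[OF mn lin, of a b v "span (q ` ?\<Omega>)"])
    fix i
    \<comment> \<open>The row facet with apices \<open>Prime i\<close> and
      \<open>Prime (i + 1)\<close> has index \<open>i + 1\<close>, hence
      \<open>Suc i\<close>.\<close>
    obtain r h where rh: "\<forall>v\<in>?\<Omega>. r \<bullet> q v \<le> h" "\<forall>v\<in>?\<Omega>. r \<bullet> q v = h \<longleftrightarrow> v \<in> row_facet m n (Suc i mod m)"
      using functional[OF row_facet_in[of "Suc i mod m"]] pos by auto
    have "r \<bullet> a k < h" if "i + 2 \<le> k" "k < i + m" for k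
    proof -
      have "Prime (k mod m) \<notin> row_facet m n (Suc i mod m)"
        using mod_window[OF that] mod_pred[OF pos(1)] by (auto simp: row_facet_def)
      then show ?thesis using rh mem(1)[of k] unfolding a_def by force
    qed
    moreover have "Vtx (Suc i mod m) (j mod n) \<in> row_facet m n (Suc i mod m)"
      "Prime (i mod m) \<in> row_facet m n (Suc i mod m)" "Prime (Suc i mod m) \<in> row_facet m n (Suc i mod m)" for j
      using pos mod_pred[OF pos(1)] by (auto simp: row_facet_def)
    ultimately show "\<exists>r h. (\<forall>j. r \<bullet> v (Suc i) j = h) \<and> r \<bullet> a i = h \<and> r \<bullet> a (Suc i) = h \<and>
      (\<forall>k. i + 2 \<le> k \<and> k < i + m \<longrightarrow> r \<bullet> a k < h)"
      using rh(2) mem by (intro exI[of _ r] exI[of _ h]) (simp add: a_def v_def)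
  next
    fix j
    obtain r h where rh: "\<forall>v\<in>?\<Omega>. r \<bullet> q v \<le> h" "\<forall>v\<in>?\<Omega>. r \<bullet> q v = h \<longleftrightarrow> v \<in> col_facet m n (Suc j mod n)"
      using functional[OF col_facet_in[of "Suc j mod n"]] pos by auto
    have "r \<bullet> b k < h" if "j + 2 \<le> k" "k < j + n" for k
    proof -
      have "DPrime (k mod n) \<notin> col_facet m n (Suc j mod n)"
        using mod_window[OF that] mod_pred[OF pos(2)] by (auto simp: col_facet_def)
      then show ?thesis using rh mem(2)[of k] unfolding b_def by force
    qed
    moreover have "Vtx (i mod m) (Suc j mod n) \<in> col_facet m n (Suc j mod n)"
      "DPrime (j mod n) \<in> col_facet m n (Suc j mod n)" "DPrime (Suc j mod n) \<in> col_facet m n (Suc j mod n)" for i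
      using pos mod_pred[OF pos(2)] by (auto simp: col_facet_def)
    ultimately show "\<exists>r h. (\<forall>i. r \<bullet> v i (Suc j) = h) \<and> r \<bullet> b j = h \<and> r \<bullet> b (Suc j) = h \<and>
      (\<forall>k. j + 2 \<le> k \<and> k < j + n \<longrightarrow> r \<bullet> b k < h)"
      using rh(2) mem by (intro exI[of _ r] exI[of _ h]) (simp add: b_def v_def)
  next
    \<comment> \<open>With index 1, the apex \<open>Prime 0\<close> off the facet needs no
      wrap-around.\<close>
    obtain r h where rh: "\<forall>v\<in>?\<Omega>. r \<bullet> q v \<le> h" "\<forall>v\<in>?\<Omega>. r \<bullet> q v = h \<longleftrightarrow> v \<in> cell_facet m n 1 1"
      using functional[OF cell_facet_in[of 1 m 1 n]] mn by auto
    have "r \<bullet> a 0 < h"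
    proof -
      have "Prime (0 mod m) \<notin> cell_facet m n 1 1" by (simp add: cell_facet_def)
      then show ?thesis using rh mem(1)[of 0] unfolding a_def by force
    qed
    moreover have "Vtx (1 mod m) (1 mod n) \<in> cell_facet m n 1 1" "Vtx (2 mod m) (1 mod n) \<in> cell_facet m n 1 1"
      "Vtx (1 mod m) (2 mod n) \<in> cell_facet m n 1 1" "Prime (1 mod m) \<in> cell_facet m n 1 1"
      "DPrime (1 mod n) \<in> cell_facet m n 1 1"
      using mn by (auto simp: cell_facet_def)
    ultimately show "\<exists>r h. r \<bullet> v 1 1 = h \<and> r \<bullet> v 2 1 = h \<and> r \<bullet> v 1 2 = h \<and> r \<bullet> a 1 = h \<and> r \<bullet> b 1 = h \<and>
      (\<forall>k. r \<bullet> a k \<le> h) \<and> r \<bullet> a 0 < h"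
      using rh mem unfolding a_def b_def v_def by (intro exI[of _ r] exI[of _ h]) blast
  qed (use \<alpha> \<beta> mem dim in \<open>simp_all add: a_def b_def v_def mod_simps span_base\<close>)
qed

theorem corollary4p8:
  fixes m n :: nat
  assumes "m \<ge> 3" and "n \<ge> 3"
  shows "subgroup (rotation_subgroup m n) (comb_symmetry_group (emn_face_lattice m n))
    \<and> (comb_symmetry_group (emn_face_lattice m n))\<lparr>carrier := rotation_subgroup m n\<rparr>
        \<cong> integer_mod_group m \<times>\<times> integer_mod_group n
    \<and> (\<forall>(P :: 'a::euclidean_space set) \<psi> H.
          polytope P
          \<and> inclusion_iso \<psi> (emn_face_lattice m n) (face_lattice P)
          \<and> subgroup H (geom_symmetry_group P)
          \<and> induces_via \<psi> (emn_face_lattice m n) P H (rotation_subgroup m n)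
          \<longrightarrow> (m, n) \<in> {(3,3), (3,4), (3,5), (3,6), (4,4)}
            \<or> (n, m) \<in> {(3,3), (3,4), (3,5), (3,6), (4,4)})"
proof (intro conjI allI impI)
  fix P :: "'a set" and \<psi> H
  assume "polytope P
          \<and> inclusion_iso \<psi> (emn_face_lattice m n) (face_lattice P)
          \<and> subgroup H (geom_symmetry_group P)
          \<and> induces_via \<psi> (emn_face_lattice m n) P H (rotation_subgroup m n)"
  then have bound: "m * n \<le> 2 * (m + n)"
    using symmetric_realization_bound[OF assms] by blast
  \<comment> \<open>In these coordinates the bound reads \<open>(k + 1) * (l + 1) \<le> 4\<close>,
    which leaves finitely many cases.\<close>
  obtain k l where kl: "m = k + 3" "n = l + 3"
    using assms by (metis add.commute le_Suc_ex)
  with bound have "k * l + k + l \<le> 3" by (simp add: algebra_simps)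
  moreover from this have "k \<le> 3" "l \<le> 3" by linarith+
  then have "k \<in> {0, 1, 2, 3}" "l \<in> {0, 1, 2, 3}" by auto
  ultimately show "(m, n) \<in> {(3,3), (3,4), (3,5), (3,6), (4,4)}
            \<or> (n, m) \<in> {(3,3), (3,4), (3,5), (3,6), (4,4)}"
    unfolding kl by (elim insertE emptyE; simp)
qed (use rotation_subgroup_structure[OF assms] in auto)

end
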